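(* There exists a shift-invariant predual $E$ of $\ell_1(\mathbb Z)$ such that, as a Banach space, $E$ is not isomorphic to $c_0$.
   Context: Scalars are complex. A closed subspace $E\subseteq\ell_\infty(\mathbb Z)$ is a concrete predual of $\ell_1(\mathbb Z)$ if the map $\iota_E:\ell_1(\mathbb Z)\to E^*$, $\iota_E(a)(x)=\sum_n x(n)a(n)$, is an isomorphism of Banach spaces (a linear homeomorphism onto $E^*$, not assumed isometric). With $\sigma(x)(n)=x(n-1)$ the bilateral shift on $\ell_\infty(\mathbb Z)$, $E$ is a shift-invariant predual if it is a concrete predual and $\sigma(E)=E$. Isomorphism of Banach spaces means linear homeomorphism, not necessarily isometric. *)

theory Defs
  imports "HOL-Analysis.Analysis"
begin

text \<open>
  Every space involved is a complex vector space of complex-valued functions with the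
  pointwise operations: \<open>\<ell>\<^sub>1(\<int>)\<close> and \<open>\<ell>\<^sub>\<infinity>(\<int>)\<close> on \<^typ>\<open>int\<close>, \<open>c\<^sub>0\<close> on \<^typ>\<open>nat\<close>, and the dual of
  a subspace \<open>E\<close> on \<open>E\<close>. A normed space is therefore a set \<open>V\<close> of functions
  together with a norm \<open>N\<close>, which is only meaningful on \<open>V\<close>.
\<close>

definition complex_subspace :: "('i \<Rightarrow> complex) set \<Rightarrow> bool" where
  "complex_subspace V \<longleftrightarrow>
     (\<lambda>i. 0) \<in> V \<and>
     (\<forall>x\<in>V. \<forall>y\<in>V. (\<lambda>i. x i + y i) \<in> V) \<and>
     (\<forall>c. \<forall>x\<in>V. (\<lambda>i. c * x i) \<in> V)"

definition complex_linear_on ::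
  "('i \<Rightarrow> complex) set \<Rightarrow> (('i \<Rightarrow> complex) \<Rightarrow> ('j \<Rightarrow> complex)) \<Rightarrow> bool" where
  "complex_linear_on V T \<longleftrightarrow>
     (\<forall>x\<in>V. \<forall>y\<in>V. T (\<lambda>i. x i + y i) = (\<lambda>j. T x j + T y j)) \<and>
     (\<forall>c. \<forall>x\<in>V. T (\<lambda>i. c * x i) = (\<lambda>j. c * T x j))"

text \<open>
  The distance is set to zero off \<open>V\<close> because \<^locale>\<open>Metric_space\<close> demands nonnegativity and
  symmetry on the whole type; the topology has underlying set \<open>V\<close> and does not depend on
  this choice.
\<close>

definition norm_dist ::
  "('i \<Rightarrow> complex) set \<Rightarrow> (('i \<Rightarrow> complex) \<Rightarrow> real) \<Rightarrow> ('i \<Rightarrow> complex) \<Rightarrow> ('i \<Rightarrow> complex) \<Rightarrow> real" where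
  "norm_dist V N x y = (if x \<in> V \<and> y \<in> V then N (\<lambda>i. x i - y i) else 0)"

definition norm_topology ::
  "('i \<Rightarrow> complex) set \<Rightarrow> (('i \<Rightarrow> complex) \<Rightarrow> real) \<Rightarrow> ('i \<Rightarrow> complex) topology" where
  "norm_topology V N = Metric_space.mtopology V (norm_dist V N)"

definition banach_isomorphism ::
  "('i \<Rightarrow> complex) set \<Rightarrow> (('i \<Rightarrow> complex) \<Rightarrow> real) \<Rightarrow>
   ('j \<Rightarrow> complex) set \<Rightarrow> (('j \<Rightarrow> complex) \<Rightarrow> real) \<Rightarrow>
   (('i \<Rightarrow> complex) \<Rightarrow> ('j \<Rightarrow> complex)) \<Rightarrow> bool" where
  "banach_isomorphism V N W M T \<longleftrightarrow>
     complex_linear_on V T \<and>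
     homeomorphic_map (norm_topology V N) (norm_topology W M) T"

definition banach_isomorphic ::
  "('i \<Rightarrow> complex) set \<Rightarrow> (('i \<Rightarrow> complex) \<Rightarrow> real) \<Rightarrow>
   ('j \<Rightarrow> complex) set \<Rightarrow> (('j \<Rightarrow> complex) \<Rightarrow> real) \<Rightarrow> bool" where
  "banach_isomorphic V N W M \<longleftrightarrow> (\<exists>T. banach_isomorphism V N W M T)"

definition l_inf :: "('i \<Rightarrow> complex) set" where
  "l_inf = {x. bounded (range x)}"

definition sup_norm :: "('i \<Rightarrow> complex) \<Rightarrow> real" where
  "sup_norm x = (SUP i. norm (x i))"

definition c_zero :: "(nat \<Rightarrow> complex) set" where
  "c_zero = {x. x \<longlonglongrightarrow> 0}"

definition l_one :: "('i \<Rightarrow> complex) set" where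
  "l_one = {a. (\<lambda>n. norm (a n)) summable_on UNIV}"

definition l_one_norm :: "('i \<Rightarrow> complex) \<Rightarrow> real" where
  "l_one_norm a = (\<Sum>\<^sub>\<infinity>n. norm (a n))"

text \<open>
  Functionals on \<open>E\<close> are represented by their extension by zero off \<open>E\<close>, so that equality of
  functions is equality on \<open>E\<close> and the pointwise operations are preserved.
\<close>

definition dual_space :: "('i \<Rightarrow> complex) set \<Rightarrow> (('i \<Rightarrow> complex) \<Rightarrow> complex) set" where
  "dual_space E = {\<phi>.
     (\<forall>x. x \<notin> E \<longrightarrow> \<phi> x = 0) \<and>
     (\<forall>x\<in>E. \<forall>y\<in>E. \<phi> (\<lambda>i. x i + y i) = \<phi> x + \<phi> y) \<and>
     (\<forall>c. \<forall>x\<in>E. \<phi> (\<lambda>i. c * x i) = c * \<phi> x) \<and>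
     (\<exists>C. \<forall>x\<in>E. norm (\<phi> x) \<le> C * sup_norm x)}"

definition dual_norm :: "('i \<Rightarrow> complex) set \<Rightarrow> (('i \<Rightarrow> complex) \<Rightarrow> complex) \<Rightarrow> real" where
  "dual_norm E \<phi> = (SUP x\<in>{x\<in>E. sup_norm x \<le> 1}. norm (\<phi> x))"

definition pairing_map ::
  "(int \<Rightarrow> complex) set \<Rightarrow> (int \<Rightarrow> complex) \<Rightarrow> ((int \<Rightarrow> complex) \<Rightarrow> complex)" where
  "pairing_map E a = (\<lambda>x. if x \<in> E then \<Sum>\<^sub>\<infinity>n. x n * a n else 0)"

definition concrete_predual :: "(int \<Rightarrow> complex) set \<Rightarrow> bool" where
  "concrete_predual E \<longleftrightarrow>
     E \<subseteq> l_inf \<and> complex_subspace E \<and>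
     closedin (norm_topology l_inf sup_norm) E \<and>
     banach_isomorphism l_one l_one_norm (dual_space E) (dual_norm E) (pairing_map E)"

definition bilateral_shift :: "(int \<Rightarrow> complex) \<Rightarrow> (int \<Rightarrow> complex)" where
  "bilateral_shift x = (\<lambda>n. x (n - 1))"

definition shift_invariant_predual :: "(int \<Rightarrow> complex) set \<Rightarrow> bool" where
  "shift_invariant_predual E \<longleftrightarrow> concrete_predual E \<and> bilateral_shift ` E = E"

end

theory Submission
  imports Defs
begin

text \<open>
  The space \<open>E\<close> consists of the uniform limits of functions \<open>x\<close> on \<open>\<int>\<close> which, on all late blocks
  around \<open>t\<^sub>n = tau n\<close>, are determined by \<open>x (t\<^sub>n + m) = \<lambda>\<^sub>i (x m + x (m - s\<^sub>i)) / 2\<close>, where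
  \<open>i = col n\<close>, \<open>\<lambda>\<^sub>i = lam i < 1\<close> tends to \<open>1\<close>, \<open>s\<^sub>i = gap i\<close>, and every colour \<open>i\<close> occurs infinitely
  often; between the blocks they vanish. So \<open>\<delta>\<^bsub>t\<^sub>n\<^esub>\<close> tends weak* to
  \<open>\<nu>\<^sub>i = \<lambda>\<^sub>i (\<delta>\<^sub>0 + \<delta>\<^bsub>-s\<^sub>i\<^esub>) / 2\<close> along the indices \<open>n\<close> of colour \<open>i\<close>.

  Every function on a window of \<open>\<int>\<close> extends to an element of \<open>E\<close> of the same sup norm, hence
  \<open>\<ell>\<^sub>1(\<int>)\<close> embeds isometrically into the dual of \<open>E\<close>. Restricting a functional to the functions
  determined by the \<open>n\<close>-th window gives an element of \<open>\<ell>\<^sub>1\<close> of that window, with norm increasing in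
  \<open>n\<close>. Passing from a large window to a small one contracts the mass lying on the outer blocks: by
  \<open>\<lambda>\<^sub>i\<close> on a block of colour \<open>i\<close>, and by \<open>1/2\<close> if \<open>i\<close> is large, because the two averaged translates
  have total weight at most \<open>1\<close> as seen from the small window. As the norms converge, no mass escapes to infinity and the
  functional belongs to \<open>\<ell>\<^sub>1(\<int>)\<close>.

  If \<open>E\<close> were isomorphic to \<open>c\<^sub>0\<close>, then in an equivalent norm on the dual every weak* limit would cost
  a fixed proportion of the norm of the mass that escapes. But for \<open>\<lambda>\<^sub>i\<close> close to \<open>1\<close> there are
  arbitrarily long chains of iterated limits \<open>\<delta>\<^sub>0, \<nu>\<^sub>i, \<nu>\<^sub>i\<^sup>2, \<dots>\<close> (up to translations) in the
  unit ball of \<open>\<ell>\<^sub>1(\<int>)\<close>, each step losing mass at least \<open>1/2\<close>.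
\<close>

section \<open>Normed spaces of functions\<close>

locale fun_normed_space =
  fixes V :: "('i \<Rightarrow> complex) set" and N :: "('i \<Rightarrow> complex) \<Rightarrow> real"
  assumes subspace: "complex_subspace V"
    and norm_nonneg: "x \<in> V \<Longrightarrow> 0 \<le> N x"
    and norm_eq_0: "x \<in> V \<Longrightarrow> N x = 0 \<Longrightarrow> x = (\<lambda>i. 0)"
    and norm_add: "x \<in> V \<Longrightarrow> y \<in> V \<Longrightarrow> N (\<lambda>i. x i + y i) \<le> N x + N y"
    and norm_scale: "x \<in> V \<Longrightarrow> N (\<lambda>i. c * x i) = norm c * N x"
begin

lemma zero_mem: "(\<lambda>i. 0) \<in> V"
  and add_mem: "x \<in> V \<Longrightarrow> y \<in> V \<Longrightarrow> (\<lambda>i. x i + y i) \<in> V"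
  and scale_mem: "x \<in> V \<Longrightarrow> (\<lambda>i. c * x i) \<in> V"
  using subspace by (auto simp: complex_subspace_def)

lemma diff_mem: "x \<in> V \<Longrightarrow> y \<in> V \<Longrightarrow> (\<lambda>i. x i - y i) \<in> V"
  using add_mem[of x "\<lambda>i. -1 * y i"] scale_mem[of y "-1"] by simp

lemma norm_zero: "N (\<lambda>i. 0) = 0"
  using norm_scale[of "\<lambda>i. 0" 0] zero_mem by simp

lemma norm_minus_commute: "x \<in> V \<Longrightarrow> y \<in> V \<Longrightarrow> N (\<lambda>i. x i - y i) = N (\<lambda>i. y i - x i)"
  using norm_scale[of "\<lambda>i. x i - y i" "-1"] diff_mem[of x y] by (simp add: minus_diff_eq)

sublocale Metric_space V "norm_dist V N"
proof
  show "norm_dist V N x y = 0 \<longleftrightarrow> x = y" if "x \<in> V" "y \<in> V" for x y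
    using that norm_eq_0[OF diff_mem[of x y]] norm_zero
    by (auto simp: norm_dist_def fun_eq_iff)
  show "norm_dist V N x z \<le> norm_dist V N x y + norm_dist V N y z"
    if "x \<in> V" "y \<in> V" "z \<in> V" for x y z
    using that norm_add[OF diff_mem[of x y] diff_mem[of y z]] by (simp add: norm_dist_def)
  show "norm_dist V N x y = norm_dist V N y x" for x y
    unfolding norm_dist_def using norm_minus_commute[of x y] by simp
qed (simp add: norm_dist_def norm_nonneg diff_mem)

lemma topspace_norm_topology: "topspace (norm_topology V N) = V"
  by (simp add: norm_topology_def)

end

lemma linear_on_diff:
  assumes "complex_linear_on V T" "complex_subspace V" "x \<in> V" "y \<in> V"
  shows "T (\<lambda>i. x i - y i) = (\<lambda>j. T x j - T y j)"
proof -
  have y': "(\<lambda>i. -1 * y i) \<in> V"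
    using assms unfolding complex_subspace_def by blast
  have "T (\<lambda>i. x i + (-1 * y i)) = (\<lambda>j. T x j + T (\<lambda>i. -1 * y i) j)"
    using assms(1)[unfolded complex_linear_on_def, THEN conjunct1, rule_format, OF \<open>x \<in> V\<close> y'] .
  also have "T (\<lambda>i. -1 * y i) = (\<lambda>j. -1 * T y j)"
    using assms(1)[unfolded complex_linear_on_def, THEN conjunct2, rule_format, OF \<open>y \<in> V\<close>] .
  finally show ?thesis by simp
qed

lemma continuous_map_of_bounded:
  assumes V: "fun_normed_space V N" and W: "fun_normed_space W M"
    and lin: "complex_linear_on V T" and maps: "T ` V \<subseteq> W"
    and bd: "\<And>x. x \<in> V \<Longrightarrow> M (T x) \<le> C * N x"
  shows "continuous_map (norm_topology V N) (norm_topology W M) T"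
proof -
  interpret V: fun_normed_space V N by fact
  interpret W: fun_normed_space W M by fact
  show ?thesis
    unfolding norm_topology_def V.metric_continuous_map[OF W.Metric_space_axioms]
  proof (intro conjI ballI allI impI maps)
    fix a and \<epsilon> :: real assume a: "a \<in> V" and \<epsilon>: "\<epsilon> > 0"
    \<comment> \<open>\<open>C\<close> may be negative or zero; the absolute value and the added 1
      make the denominator positive.\<close>
    define \<delta> where "\<delta> = \<epsilon> / (\<bar>C\<bar> + 1)"
    have "norm_dist W M (T a) (T x) < \<epsilon>" if x: "x \<in> V" and d: "norm_dist V N a x < \<delta>" for x
    proof -
      have mem: "(\<lambda>i. a i - x i) \<in> V" using a x V.diff_mem by blast
      have "norm_dist W M (T a) (T x) = M (T (\<lambda>i. a i - x i))"
        using maps a x linear_on_diff[OF lin V.subspace a x] by (auto simp: norm_dist_def)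
      also have "\<dots> \<le> C * N (\<lambda>i. a i - x i)" using bd mem by blast
      also have "\<dots> \<le> (\<bar>C\<bar> + 1) * N (\<lambda>i. a i - x i)"
        using V.norm_nonneg[OF mem] by (intro mult_right_mono) auto
      also have "\<dots> < (\<bar>C\<bar> + 1) * \<delta>"
        using d a x by (intro mult_strict_left_mono) (auto simp: norm_dist_def)
      also have "\<dots> = \<epsilon>" by (simp add: \<delta>_def field_simps)
      finally show ?thesis .
    qed
    moreover have "\<delta> > 0" using \<epsilon> by (simp add: \<delta>_def)
    ultimately show "\<exists>\<delta>>0. \<forall>x. x \<in> V \<and> norm_dist V N a x < \<delta> \<longrightarrow> norm_dist W M (T a) (T x) < \<epsilon>"
      by blast
  qed
qed

lemma bounded_of_continuous_map:
  assumes V: "fun_normed_space V N" and W: "fun_normed_space W M"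
    and lin: "complex_linear_on V T"
    and cont: "continuous_map (norm_topology V N) (norm_topology W M) T"
  obtains C where "C > 0" "\<And>x. x \<in> V \<Longrightarrow> M (T x) \<le> C * N x"
proof -
  interpret V: fun_normed_space V N by fact
  interpret W: fun_normed_space W M by fact
  have maps: "T ` V \<subseteq> W" and
    "\<forall>a\<in>V. \<forall>\<epsilon>>0. \<exists>\<delta>>0. \<forall>x. x \<in> V \<and> norm_dist V N a x < \<delta> \<longrightarrow> norm_dist W M (T a) (T x) < \<epsilon>"
    using cont unfolding norm_topology_def V.metric_continuous_map[OF W.Metric_space_axioms]
    by auto
  then obtain \<delta> where \<delta>: "\<delta> > 0" and
    d: "\<And>x. x \<in> V \<Longrightarrow> norm_dist V N (\<lambda>i. 0) x < \<delta> \<Longrightarrow> norm_dist W M (T (\<lambda>i. 0)) (T x) < 1"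
    using V.zero_mem by (metis zero_less_one)
  have scale: "T (\<lambda>i. c * x i) = (\<lambda>j. c * T x j)" if "x \<in> V" for c x
    using lin that unfolding complex_linear_on_def by blast
  have T0: "T (\<lambda>i. 0) = (\<lambda>j. 0)"
    using scale[OF V.zero_mem, of 0] by simp
  have small: "M (T x) < 1" if x: "x \<in> V" and "N x < \<delta>" for x
  proof -
    have "N (\<lambda>i. - x i) = N x" using V.norm_scale[OF x, of "-1"] by simp
    moreover have "M (\<lambda>i. - T x i) = M (T x)"
      using W.norm_scale[of "T x" "-1"] maps x by auto
    ultimately show ?thesis
      using d[OF x] that maps V.zero_mem W.zero_mem by (auto simp: norm_dist_def T0)
  qed
  have "M (T x) \<le> (2 / \<delta>) * N x" if x: "x \<in> V" for x
  proof (cases "N x = 0")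
    case True
    then have "x = (\<lambda>i. 0)" using V.norm_eq_0 x by blast
    then show ?thesis using T0 W.norm_zero V.norm_zero by simp
  next
    case False
    then have pos: "N x > 0" using V.norm_nonneg[OF x] by linarith
    \<comment> \<open>Rescaling to norm \<open>\<delta> / 2\<close> puts the vector strictly inside
      the ball that is mapped into the unit ball, whence the constant
      \<open>2 / \<delta>\<close>.\<close>
    define c where "c = \<delta> / (2 * N x)"
    have c: "c > 0" using pos \<delta> by (simp add: c_def)
    have "N (\<lambda>i. complex_of_real c * x i) = \<delta> / 2"
      using V.norm_scale[OF x, of "complex_of_real c"] c pos \<delta>
      by (simp add: c_def norm_divide norm_mult del: of_real_divide of_real_mult)
    then have "M (T (\<lambda>i. complex_of_real c * x i)) < 1"
      using \<delta> small V.scale_mem[OF x] by simp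
    then have "c * M (T x) < 1"
      using scale[OF x] W.norm_scale[of "T x" "complex_of_real c"] maps x c by auto
    then show ?thesis
      using pos \<delta> by (simp add: c_def field_simps)
  qed
  then show ?thesis using \<delta> by (intro that[of "2 / \<delta>"]) auto
qed

lemma linear_on_inv_into:
  assumes lin: "complex_linear_on V T" and sub: "complex_subspace V" and inj: "inj_on T V"
  shows "complex_linear_on (T ` V) (inv_into V T)"
  unfolding complex_linear_on_def
proof (intro conjI ballI allI)
  fix c x y assume x: "x \<in> T ` V" and y: "y \<in> T ` V"
  obtain u v where u: "u \<in> V" "x = T u" and v: "v \<in> V" "y = T v" using x y by auto
  have uv: "(\<lambda>i. u i + v i) \<in> V" and cu: "(\<lambda>i. c * u i) \<in> V"
    using sub u v unfolding complex_subspace_def by blast+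
  have 1: "T (\<lambda>i. u i + v i) = (\<lambda>i. x i + y i)" and 2: "T (\<lambda>i. c * u i) = (\<lambda>i. c * x i)"
    using lin u v unfolding complex_linear_on_def by blast+
  show "inv_into V T (\<lambda>i. x i + y i) = (\<lambda>j. inv_into V T x j + inv_into V T y j)"
    unfolding 1[symmetric] inv_into_f_f[OF inj uv] using u v inj by simp
  show "inv_into V T (\<lambda>i. c * x i) = (\<lambda>j. c * inv_into V T x j)"
    unfolding 2[symmetric] inv_into_f_f[OF inj cu] using u inj by simp
qed

lemma banach_isomorphismI:
  assumes V: "fun_normed_space V N" and W: "fun_normed_space W M"
    and lin: "complex_linear_on V T" and onto: "T ` V = W"
    and bd: "\<And>x. x \<in> V \<Longrightarrow> M (T x) \<le> C * N x"
    and below: "\<And>x. x \<in> V \<Longrightarrow> N x \<le> K * M (T x)"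
  shows "banach_isomorphism V N W M T"
proof -
  interpret V: fun_normed_space V N by fact
  interpret W: fun_normed_space W M by fact
  have inj: "inj_on T V"
  proof (rule inj_onI)
    fix x y assume xy: "x \<in> V" "y \<in> V" "T x = T y"
    let ?d = "\<lambda>i. x i - y i"
    have d: "?d \<in> V" using xy V.diff_mem by blast
    have "T ?d = (\<lambda>j. 0)" using linear_on_diff[OF lin V.subspace xy(1,2)] xy by simp
    then have "N ?d = 0" using below[OF d] V.norm_nonneg[OF d] W.norm_zero by simp
    then show "x = y" using V.norm_eq_0[OF d] by (auto simp: fun_eq_iff)
  qed
  have "continuous_map (norm_topology V N) (norm_topology W M) T"
    using continuous_map_of_bounded[OF V W lin _ bd] onto by blast
  moreover have "continuous_map (norm_topology W M) (norm_topology V N) (inv_into V T)"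
  proof (rule continuous_map_of_bounded[OF W V, where C = K])
    show "complex_linear_on W (inv_into V T)"
      using linear_on_inv_into[OF lin V.subspace inj] onto by simp
    show "inv_into V T ` W \<subseteq> V" using onto by (auto intro: inv_into_into)
    show "N (inv_into V T x) \<le> K * M x" if "x \<in> W" for x
      using below[of "inv_into V T x"] that onto by (simp add: f_inv_into_f inv_into_into)
  qed
  ultimately have "homeomorphic_maps (norm_topology V N) (norm_topology W M) T (inv_into V T)"
    unfolding homeomorphic_maps_def V.topspace_norm_topology W.topspace_norm_topology
    using inj onto by (auto simp: f_inv_into_f)
  then show ?thesis
    using lin homeomorphic_map_maps unfolding banach_isomorphism_def by blast
qed

text \<open>Extracts an inverse and a single constant valid in both directions; the comparison with
  \<open>c_zero\<close> is carried out entirely with these bounds.\<close>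

lemma banach_isomorphismE:
  assumes V: "fun_normed_space V N" and W: "fun_normed_space W M"
    and iso: "banach_isomorphism V N W M T"
  obtains G C where "C > 0" "complex_linear_on W G" "\<And>x. x \<in> V \<Longrightarrow> T x \<in> W"
    "\<And>y. y \<in> W \<Longrightarrow> G y \<in> V" "\<And>x. x \<in> V \<Longrightarrow> G (T x) = x"
    "\<And>x. x \<in> V \<Longrightarrow> M (T x) \<le> C * N x" "\<And>y. y \<in> W \<Longrightarrow> N (G y) \<le> C * M y"
proof -
  interpret V: fun_normed_space V N by fact
  interpret W: fun_normed_space W M by fact
  have lin: "complex_linear_on V T"
    using iso by (simp add: banach_isomorphism_def)
  obtain G where "homeomorphic_maps (norm_topology V N) (norm_topology W M) T G"
    using iso homeomorphic_map_maps unfolding banach_isomorphism_def by blast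
  then have cT: "continuous_map (norm_topology V N) (norm_topology W M) T"
    and cG: "continuous_map (norm_topology W M) (norm_topology V N) G"
    and GT: "\<And>x. x \<in> V \<Longrightarrow> G (T x) = x" and TG: "\<And>y. y \<in> W \<Longrightarrow> T (G y) = y"
    by (auto simp: homeomorphic_maps_def V.topspace_norm_topology W.topspace_norm_topology)
  have mT: "T x \<in> W" if "x \<in> V" for x
    using cT that continuous_map_image_subset_topspace[OF cT]
    by (auto simp: V.topspace_norm_topology W.topspace_norm_topology)
  have mG: "G y \<in> V" if "y \<in> W" for y
    using cG that continuous_map_image_subset_topspace[OF cG]
    by (auto simp: V.topspace_norm_topology W.topspace_norm_topology)
  have TV: "T ` V = W" using mT mG TG by force
  have inj: "inj_on T V" by (rule inj_on_inverseI[of V G]) (rule GT)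
  have inv_eq: "inv_into V T y = G y" if "y \<in> W" for y
    using inv_into_f_f[OF inj, of "G y"] mG[OF that] TG[OF that] by simp
  have linG: "complex_linear_on W G"
    using linear_on_inv_into[OF lin V.subspace inj] inv_eq W.add_mem W.scale_mem
    unfolding TV complex_linear_on_def by simp
  obtain C1 where C1: "C1 > 0" "\<And>x. x \<in> V \<Longrightarrow> M (T x) \<le> C1 * N x"
    using bounded_of_continuous_map[OF V W lin cT] by blast
  obtain C2 where C2: "C2 > 0" "\<And>y. y \<in> W \<Longrightarrow> N (G y) \<le> C2 * M y"
    using bounded_of_continuous_map[OF W V linG cG] by blast
  show ?thesis
  proof (rule that[of "max C1 C2" G])
    show "M (T x) \<le> max C1 C2 * N x" if "x \<in> V" for x
      using C1(2)[OF that] mult_right_mono[OF max.cobounded1 V.norm_nonneg[OF that], of C1 C2]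
      by linarith
    show "N (G y) \<le> max C1 C2 * M y" if "y \<in> W" for y
      using C2(2)[OF that] mult_right_mono[OF max.cobounded2 W.norm_nonneg[OF that], of C2 C1]
      by linarith
  qed (use C1 linG mT mG GT in auto)
qed

section \<open>The sup norm, the \<open>l_one\<close> norm and the dual norm\<close>

lemma norm_le_sup_norm: "x \<in> l_inf \<Longrightarrow> norm (x i) \<le> sup_norm x"
  unfolding sup_norm_def l_inf_def
  by (rule cSUP_upper) (auto simp: bdd_above_norm image_image[symmetric])

lemma sup_norm_le: "(\<And>i. norm (x i) \<le> B) \<Longrightarrow> sup_norm x \<le> B"
  unfolding sup_norm_def by (rule cSUP_least) auto

lemma l_infI: "(\<And>i. norm (x i) \<le> B) \<Longrightarrow> x \<in> l_inf"
  unfolding l_inf_def by (auto simp: bounded_iff)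

lemma sup_norm_nonneg: "x \<in> l_inf \<Longrightarrow> 0 \<le> sup_norm x"
  using norm_le_sup_norm[of x undefined] norm_ge_zero order_trans by blast

lemma l_inf_add: "x \<in> l_inf \<Longrightarrow> y \<in> l_inf \<Longrightarrow> (\<lambda>i. x i + y i) \<in> l_inf"
  by (rule l_infI[of _ "sup_norm x + sup_norm y"])
    (meson add_mono norm_le_sup_norm norm_triangle_le)

lemma l_inf_scale: "x \<in> l_inf \<Longrightarrow> (\<lambda>i. c * x i) \<in> l_inf"
  by (rule l_infI[of _ "norm c * sup_norm x"])
    (simp add: norm_mult norm_le_sup_norm mult_left_mono)

lemma fun_normed_space_sup_norm:
  assumes "complex_subspace V" and sub: "V \<subseteq> l_inf"
  shows "fun_normed_space V sup_norm"
proof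
  fix x assume x: "x \<in> V"
  then have x': "x \<in> l_inf" using sub by blast
  show "0 \<le> sup_norm x" using sup_norm_nonneg[OF x'] .
  show "x = (\<lambda>i. 0)" if "sup_norm x = 0"
    using norm_le_sup_norm[OF x'] that by auto
  show "sup_norm (\<lambda>i. x i + y i) \<le> sup_norm x + sup_norm y" if "y \<in> V" for y
    using that sub x'
    by (intro sup_norm_le) (meson add_mono norm_le_sup_norm norm_triangle_le subsetD)
  show "sup_norm (\<lambda>i. c * x i) = norm c * sup_norm x" for c
  proof (cases "c = 0")
    case True
    then show ?thesis by (simp add: sup_norm_def)
  next
    case False
    have "norm (x i) \<le> sup_norm (\<lambda>i. c * x i) / norm c" for i
      using norm_le_sup_norm[OF l_inf_scale[OF x'], of c i] False
      by (simp add: norm_mult field_simps)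
    then have "sup_norm x \<le> sup_norm (\<lambda>i. c * x i) / norm c" by (rule sup_norm_le)
    moreover have "sup_norm (\<lambda>i. c * x i) \<le> norm c * sup_norm x"
      by (rule sup_norm_le) (simp add: norm_mult norm_le_sup_norm[OF x'] mult_left_mono)
    ultimately show ?thesis using False by (simp add: field_simps)
  qed
qed (fact assms)

lemma complex_subspace_l_inf: "complex_subspace l_inf"
  unfolding complex_subspace_def
  by (auto intro: l_inf_add l_inf_scale l_infI[of _ 0])

lemma c_zero_subset_l_inf: "c_zero \<subseteq> l_inf"
  unfolding c_zero_def l_inf_def using convergent_imp_bounded by blast

lemma complex_subspace_c_zero: "complex_subspace c_zero"
  unfolding complex_subspace_def c_zero_def
  by (auto intro: tendsto_add_zero tendsto_mult_right_zero)

lemma fun_normed_space_l_one: "fun_normed_space (l_one :: ('i \<Rightarrow> complex) set) l_one_norm"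
proof
  have add: "(\<lambda>i. x i + y i) \<in> l_one" if "x \<in> l_one" "y \<in> l_one" for x y :: "'i \<Rightarrow> complex"
  proof -
    have "(\<lambda>i. norm (x i) + norm (y i)) summable_on UNIV"
      using that by (intro summable_on_add) (auto simp: l_one_def)
    then have "(\<lambda>i. norm (x i + y i)) summable_on UNIV"
      by (rule summable_on_comparison_test) (auto simp: norm_triangle_ineq)
    then show ?thesis by (simp add: l_one_def)
  qed
  have scale: "(\<lambda>i. c * x i) \<in> l_one" if "x \<in> l_one" for c and x :: "'i \<Rightarrow> complex"
    using that by (auto simp: l_one_def norm_mult intro: summable_on_cmult_right)
  show "complex_subspace (l_one :: ('i \<Rightarrow> complex) set)"
    unfolding complex_subspace_def by (auto simp: add scale) (simp add: l_one_def)
  fix x y :: "'i \<Rightarrow> complex" assume x: "x \<in> l_one"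
  show "0 \<le> l_one_norm x"
    unfolding l_one_norm_def by (rule infsum_nonneg) auto
  show "l_one_norm (\<lambda>i. c * x i) = norm c * l_one_norm x" for c
    by (simp add: l_one_norm_def norm_mult infsum_cmult_right')
  show "x = (\<lambda>i. 0)" if "l_one_norm x = 0"
  proof
    show "x i = 0" for i
      using nonneg_infsum_le_0D[of "\<lambda>i. norm (x i)" UNIV i] that x
      by (simp add: l_one_norm_def l_one_def)
  qed
  show "l_one_norm (\<lambda>i. x i + y i) \<le> l_one_norm x + l_one_norm y" if y: "y \<in> l_one"
  proof -
    have "l_one_norm (\<lambda>i. x i + y i) \<le> (\<Sum>\<^sub>\<infinity>i. norm (x i) + norm (y i))"
      unfolding l_one_norm_def using add[OF x y] x y
      by (intro infsum_mono summable_on_add) (auto simp: l_one_def norm_triangle_ineq)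
    also have "\<dots> = l_one_norm x + l_one_norm y"
      unfolding l_one_norm_def using x y by (intro infsum_add) (auto simp: l_one_def)
    finally show ?thesis .
  qed
qed

text \<open>The constant in \<open>dual_space\<close> carries no sign. Replacing it by its maximum
  with 0 preserves the bound, because the sup norm is nonnegative, and allows later estimates to
  multiply by it.\<close>

lemma dual_space_bound:
  assumes "E \<subseteq> l_inf" "\<phi> \<in> dual_space E"
  obtains C where "C \<ge> 0" "\<And>x. x \<in> E \<Longrightarrow> norm (\<phi> x) \<le> C * sup_norm x"
proof -
  obtain C where C: "\<And>x. x \<in> E \<Longrightarrow> norm (\<phi> x) \<le> C * sup_norm x"
    using assms unfolding dual_space_def by blast
  have "norm (\<phi> x) \<le> max C 0 * sup_norm x" if "x \<in> E" for x
    using C[OF that] mult_right_mono[OF max.cobounded1, of "sup_norm x" C 0] that assms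
      sup_norm_nonneg by fastforce
  then show ?thesis by (intro that[of "max C 0"]) auto
qed

lemma dual_norm_upper:
  assumes "E \<subseteq> l_inf" "\<phi> \<in> dual_space E" "x \<in> E" "sup_norm x \<le> 1"
  shows "norm (\<phi> x) \<le> dual_norm E \<phi>"
proof -
  obtain C where C: "C \<ge> 0" "\<And>x. x \<in> E \<Longrightarrow> norm (\<phi> x) \<le> C * sup_norm x"
    using dual_space_bound[OF assms(1,2)] by blast
  have "norm (\<phi> x) \<le> C" if "x \<in> E" "sup_norm x \<le> 1" for x
    using C(2)[OF that(1)] mult_left_mono[OF that(2) C(1)] by simp
  then have "bdd_above ((\<lambda>x. norm (\<phi> x)) ` {x \<in> E. sup_norm x \<le> 1})"
    by (intro bdd_aboveI2) auto
  then show ?thesis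
    unfolding dual_norm_def by (rule cSUP_upper2) (use assms in auto)
qed

lemma dual_norm_le:
  assumes "complex_subspace E" "\<And>x. x \<in> E \<Longrightarrow> sup_norm x \<le> 1 \<Longrightarrow> norm (\<phi> x) \<le> B"
  shows "dual_norm E \<phi> \<le> B"
proof -
  have "(\<lambda>i. 0) \<in> {x \<in> E. sup_norm x \<le> 1}"
    using assms(1) unfolding complex_subspace_def by (auto intro: sup_norm_le)
  then show ?thesis
    unfolding dual_norm_def by (intro cSUP_least) (use assms(2) in auto)
qed

lemma fun_normed_space_dual:
  assumes sub: "complex_subspace E" and E: "E \<subseteq> l_inf"
  shows "fun_normed_space (dual_space E) (dual_norm E)"
proof
  interpret E: fun_normed_space E sup_norm
    using fun_normed_space_sup_norm[OF assms] .
  show "complex_subspace (dual_space E)"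
    unfolding complex_subspace_def
  proof (intro conjI ballI allI)
    show "(\<lambda>x. 0) \<in> dual_space E"
      by (auto simp: dual_space_def intro!: exI[of _ 0])
    fix \<phi> assume \<phi>: "\<phi> \<in> dual_space E"
    obtain C where C: "\<And>x. x \<in> E \<Longrightarrow> norm (\<phi> x) \<le> C * sup_norm x"
      using dual_space_bound[OF E \<phi>] by blast
    have "norm (c * \<phi> x) \<le> (norm c * C) * sup_norm x" if "x \<in> E" for c x
      using mult_left_mono[OF C[OF that], of "norm c"] by (simp add: norm_mult mult.assoc)
    then have "\<exists>K. \<forall>x\<in>E. norm (c * \<phi> x) \<le> K * sup_norm x" for c by blast
    then show "(\<lambda>x. c * \<phi> x) \<in> dual_space E" for c
      using \<phi> unfolding dual_space_def mem_Collect_eq by (simp add: algebra_simps)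
    fix \<psi> assume \<psi>: "\<psi> \<in> dual_space E"
    obtain K where K: "\<And>x. x \<in> E \<Longrightarrow> norm (\<psi> x) \<le> K * sup_norm x"
      using dual_space_bound[OF E \<psi>] by blast
    have "norm (\<phi> x + \<psi> x) \<le> (C + K) * sup_norm x" if "x \<in> E" for x
      using C[OF that] K[OF that] norm_triangle_ineq[of "\<phi> x" "\<psi> x"]
      by (simp add: distrib_right)
    then have "\<exists>K. \<forall>x\<in>E. norm (\<phi> x + \<psi> x) \<le> K * sup_norm x" by blast
    then show "(\<lambda>x. \<phi> x + \<psi> x) \<in> dual_space E"
      using \<phi> \<psi> unfolding dual_space_def mem_Collect_eq by (simp add: algebra_simps)
  qed
  then have add: "(\<lambda>x. \<phi> x + \<psi> x) \<in> dual_space E"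
    and scale: "(\<lambda>x. c * \<phi> x) \<in> dual_space E"
    if "\<phi> \<in> dual_space E" "\<psi> \<in> dual_space E" for \<phi> \<psi> c
    using that unfolding complex_subspace_def by blast+
  fix \<phi> assume \<phi>: "\<phi> \<in> dual_space E"
  have lin: "\<phi> (\<lambda>i. c * x i) = c * \<phi> x" if "x \<in> E" for c x
    using \<phi> that unfolding dual_space_def by blast
  have zero: "\<phi> (\<lambda>i. 0) = 0"
    using lin[OF E.zero_mem, of 0] by simp
  show "0 \<le> dual_norm E \<phi>"
    using dual_norm_upper[OF E \<phi> E.zero_mem] E.norm_zero by (simp add: zero)
  show "\<phi> = (\<lambda>x. 0)" if "dual_norm E \<phi> = 0"
  proof
    fix x
    show "\<phi> x = 0"
    proof (cases "x \<in> E \<and> x \<noteq> (\<lambda>i. 0)")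
      case False
      then show ?thesis using zero \<phi> unfolding dual_space_def by blast
    next
      case True
      then have x: "x \<in> E" and pos: "sup_norm x > 0"
        using E.norm_eq_0 E.norm_nonneg by (auto simp: less_le)
      have "norm (\<phi> (\<lambda>i. complex_of_real (inverse (sup_norm x)) * x i)) \<le> dual_norm E \<phi>"
        using x pos by (intro dual_norm_upper[OF E \<phi>] E.scale_mem) (simp_all only: E.norm_scale[OF x] norm_of_real, simp)
      then show ?thesis using pos that by (simp add: lin[OF x])
    qed
  qed
  show "dual_norm E (\<lambda>x. \<phi> x + \<psi> x) \<le> dual_norm E \<phi> + dual_norm E \<psi>" if \<psi>: "\<psi> \<in> dual_space E" for \<psi>
    by (rule dual_norm_le[OF sub])
      (meson add_mono norm_triangle_le dual_norm_upper[OF E \<phi>] dual_norm_upper[OF E \<psi>])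
  show "dual_norm E (\<lambda>x. c * \<phi> x) = norm c * dual_norm E \<phi>" for c
  proof (cases "c = 0")
    case True
    have "dual_norm E (\<lambda>x. 0) \<le> 0" by (rule dual_norm_le[OF sub]) simp
    moreover have "0 \<le> dual_norm E (\<lambda>x. 0)"
      using dual_norm_upper[OF E, of "\<lambda>x. 0" "\<lambda>i. 0"] scale[OF \<phi> \<phi>, of 0] E.zero_mem E.norm_zero by simp
    ultimately show ?thesis using True by simp
  next
    case False
    have "norm (\<phi> x) \<le> dual_norm E (\<lambda>x. c * \<phi> x) / norm c" if "x \<in> E" "sup_norm x \<le> 1" for x
      using dual_norm_upper[OF E scale[OF \<phi> \<phi>] that, of c] False
      by (simp add: norm_mult field_simps)
    then have "dual_norm E \<phi> \<le> dual_norm E (\<lambda>x. c * \<phi> x) / norm c"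
      by (intro dual_norm_le[OF sub])
    moreover have "dual_norm E (\<lambda>x. c * \<phi> x) \<le> norm c * dual_norm E \<phi>"
      by (rule dual_norm_le[OF sub]) (simp add: norm_mult dual_norm_upper[OF E \<phi>] mult_left_mono)
    ultimately show ?thesis using False by (simp add: field_simps)
  qed
qed

section \<open>The space\<close>

text \<open>
  The block around \<open>tau n\<close> is disjoint from the \<open>n\<close>-th window and ends at the latest at \<open>16\<^sup>n\<^sup>+\<^sup>1\<close>. The windows
  are four times wider than the support of the functions that occur, which leaves room for a
  translate by \<open>gap i\<close> with \<open>i \<le> n\<close>.
\<close>

definition tau :: "nat \<Rightarrow> int" where "tau n = 9 * 16 ^ n"

definition gap :: "nat \<Rightarrow> int" where "gap i = 3 * 16 ^ i"

definition win :: "nat \<Rightarrow> int set" where "win n = {- 4 * 16 ^ n..4 * 16 ^ n}"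

text \<open>Colour \<open>i\<close> occurs exactly at the indices \<open>prod_encode (i, m)\<close>,
  hence infinitely often. Since the colour never exceeds the index, the translate by
  \<open>gap (col n)\<close> fits the scale \<open>16 ^ n\<close>.\<close>

definition col :: "nat \<Rightarrow> nat" where "col n = fst (prod_decode n)"

text \<open>The sequence increases to 1 but stays below it. Monotonicity lets \<open>lam n\<close>
  control all colours up to \<open>n\<close>; closeness to 1 keeps long iterated averages
  large.\<close>

definition lam :: "nat \<Rightarrow> real" where "lam i = 1 - 1 / (real i + 2)"

definition avg :: "nat \<Rightarrow> (int \<Rightarrow> complex) \<Rightarrow> int \<Rightarrow> complex" where
  "avg i f k = complex_of_real (lam i / 2) * (f k + f (k - gap i))"

text \<open>For \<open>f\<close> supported in window \<open>n\<close> this leaves \<open>f\<close>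
  in place and appends its average as a new block around \<open>tau n\<close>.\<close>

definition grow :: "nat \<Rightarrow> (int \<Rightarrow> complex) \<Rightarrow> int \<Rightarrow> complex" where
  "grow n f k = f k + avg (col n) f (k - tau n)"

definition trunc :: "nat \<Rightarrow> (int \<Rightarrow> complex) \<Rightarrow> int \<Rightarrow> complex" where
  "trunc n f = (\<lambda>k. if k \<in> win n then f k else 0)"

text \<open>Only the values beyond window \<open>n\<close> are constrained: each later window is the
  growth of the preceding one. Levels therefore increase with \<open>n\<close>, and each is a copy
  of the functions on its window.\<close>

definition lvl :: "nat \<Rightarrow> (int \<Rightarrow> complex) set" where
  "lvl n = {x. \<forall>j\<ge>n. trunc (Suc j) x = grow j (trunc j x)}"

section \<open>Supports and bounds for one growth step\<close>

lemma lam_bounds: "1 / 2 \<le> lam i" "lam i < 1"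
  by (auto simp: lam_def field_simps)

lemma lam_mono: "i \<le> j \<Longrightarrow> lam i \<le> lam j"
  by (simp add: lam_def frac_le)

lemma col_le: "col n \<le> n"
  unfolding col_def using le_prod_encode_1[of "fst (prod_decode n)" "snd (prod_decode n)"] by simp

lemma gap_col_le: "gap (col n) \<le> 3 * 16 ^ n" "gap i > 0"
  by (auto simp: gap_def col_le power_increasing)

lemma finite_win [simp]: "finite (win n)"
  by (simp add: win_def)

lemma win_mono: "m \<le> n \<Longrightarrow> win m \<subseteq> win n"
proof -
  assume "m \<le> n"
  then have "(16::int) ^ m \<le> 16 ^ n" by (rule power_increasing) simp
  then show ?thesis by (auto simp: win_def)
qed

lemma in_win_iff: "k \<in> win n \<longleftrightarrow> \<bar>k\<bar> \<le> 4 * 16 ^ n"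
  by (auto simp: win_def)

lemma eventually_in_win: "nat \<bar>k\<bar> \<le> n \<Longrightarrow> k \<in> win n"
proof -
  assume n: "nat \<bar>k\<bar> \<le> n"
  have "int n < 16 ^ n"
  proof (induction n)
    case (Suc n)
    have "(16::int) ^ n \<ge> 1" by simp
    with Suc show ?case unfolding power_Suc of_nat_Suc by linarith
  qed simp
  then show ?thesis using n unfolding in_win_iff by linarith
qed

lemma avg_bound:
  assumes "norm (f k) \<le> B" "norm (f (k - gap i)) \<le> B"
  shows "norm (avg i f k) \<le> lam i * B"
proof -
  have "norm (f k + f (k - gap i)) \<le> 2 * B"
    using assms norm_triangle_ineq[of "f k" "f (k - gap i)"] by linarith
  then have "lam i / 2 * norm (f k + f (k - gap i)) \<le> lam i / 2 * (2 * B)"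
    using lam_bounds(1)[of i] by (intro mult_left_mono) auto
  then show ?thesis
    using lam_bounds(1)[of i] by (simp add: avg_def norm_mult)
qed

lemma avg_add: "avg i (\<lambda>k. f k + g k) = (\<lambda>k. avg i f k + avg i g k)"
  by (simp add: avg_def fun_eq_iff algebra_simps add_divide_distrib)

lemma avg_scale: "avg i (\<lambda>k. a * f k) = (\<lambda>k. a * avg i f k)"
  by (simp add: avg_def fun_eq_iff algebra_simps)

lemma trunc_support: "trunc n f = f \<Longrightarrow> k \<notin> win n \<Longrightarrow> f k = 0"
  by (metis trunc_def)

lemma grow_low:
  assumes "trunc n f = f" "k \<le> 4 * 16 ^ n"
  shows "grow n f k = f k"
proof -
  have "(16::int) ^ n > 0" by simp
  then have "k - tau n \<notin> win n" "k - tau n - gap (col n) \<notin> win n"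
    using assms(2) gap_col_le(2)[of "col n"] unfolding tau_def in_win_iff by linarith+
  then show ?thesis
    using trunc_support[OF assms(1)] by (simp add: grow_def avg_def)
qed

lemma grow_high:
  assumes "trunc n f = f" "k > 4 * 16 ^ n"
  shows "grow n f k = avg (col n) f (k - tau n)"
  using trunc_support[OF assms(1), of k] assms(2) by (simp add: grow_def win_def)

text \<open>As \<open>gap (col n)\<close> is at most \<open>3 * 16 ^ n\<close>, the two translates
  making up the appended block live between \<open>5 * 16 ^ n\<close> and
  \<open>16 * 16 ^ n\<close>.\<close>

lemma grow_zero:
  assumes f: "trunc n f = f"
    and k: "k < - 4 * 16 ^ n \<or> 4 * 16 ^ n < k \<and> k < 5 * 16 ^ n \<or> 16 * 16 ^ n < k"
  shows "grow n f k = 0"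
proof -
  have pos: "(16::int) ^ n > 0" by simp
  show ?thesis
  proof (cases "k < - 4 * 16 ^ n")
    case True
    then show ?thesis
      using grow_low[OF f, of k] trunc_support[OF f, of k] pos by (simp add: win_def)
  next
    case False
    then have "k > 4 * 16 ^ n" using k pos by linarith
    moreover have "k - tau n \<notin> win n" "k - tau n - gap (col n) \<notin> win n"
      using k False pos gap_col_le(1)[of n] gap_col_le(2)[of "col n"]
      unfolding tau_def in_win_iff by linarith+
    ultimately show ?thesis
      using grow_high[OF f, of k] trunc_support[OF f, of "k - tau n"]
        trunc_support[OF f, of "k - tau n - gap (col n)"] by (simp add: avg_def)
  qed
qed

lemma grow_support: "trunc n f = f \<Longrightarrow> trunc (Suc n) (grow n f) = grow n f"
  using grow_zero[of n f]
  by (auto simp: fun_eq_iff trunc_def win_def) (smt (verit, best) power_Suc zero_less_power)+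

lemma grow_bound:
  assumes f: "trunc n f = f" and B: "\<And>k. norm (f k) \<le> B"
  shows "norm (grow n f k) \<le> B"
proof (cases "k \<le> 4 * 16 ^ n")
  case True
  then show ?thesis using grow_low[OF f] B by simp
next
  case False
  have "B \<ge> 0" using B[of 0] norm_ge_zero order_trans by blast
  have "norm (grow n f k) \<le> lam (col n) * B"
    using False grow_high[OF f, of k] avg_bound[of f _ B] B by simp
  also have "\<dots> \<le> 1 * B"
    using lam_bounds(2) \<open>B \<ge> 0\<close> by (intro mult_right_mono) (auto simp: less_imp_le)
  finally show ?thesis by simp
qed

lemma trunc_trunc: "m \<le> n \<Longrightarrow> trunc m (trunc n f) = trunc m f"
  using win_mono[of m n] by (auto simp: trunc_def fun_eq_iff)

lemma trunc_idem [simp]: "trunc n (trunc n f) = trunc n f"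
  by (simp add: trunc_trunc)

section \<open>Functions determined by one window\<close>

lemma lvlD: "x \<in> lvl n \<Longrightarrow> n \<le> j \<Longrightarrow> trunc (Suc j) x = grow j (trunc j x)"
  by (simp add: lvl_def)

lemma lvl_apply:
  assumes "x \<in> lvl n" "n \<le> j" "k \<in> win (Suc j)"
  shows "x k = grow j (trunc j x) k"
  using fun_cong[OF lvlD[OF assms(1,2)], of k] assms(3) unfolding trunc_def by simp

lemma lvl_mono: "m \<le> n \<Longrightarrow> lvl m \<subseteq> lvl n"
  by (auto simp: lvl_def)

lemma lvl_add:
  assumes "x \<in> lvl n" "y \<in> lvl n"
  shows "(\<lambda>k. x k + y k) \<in> lvl n"
proof -
  have "trunc j (\<lambda>k. x k + y k) = (\<lambda>k. trunc j x k + trunc j y k)" for j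
    by (auto simp: trunc_def)
  moreover have "grow j (\<lambda>k. f k + g k) = (\<lambda>k. grow j f k + grow j g k)" for j f g
    by (auto simp: grow_def avg_def algebra_simps)
  ultimately show ?thesis using assms by (simp add: lvl_def)
qed

lemma lvl_scale:
  assumes "x \<in> lvl n"
  shows "(\<lambda>k. c * x k) \<in> lvl n"
proof -
  have "trunc j (\<lambda>k. c * x k) = (\<lambda>k. c * trunc j x k)" for j
    by (auto simp: trunc_def)
  moreover have "grow j (\<lambda>k. c * f k) = (\<lambda>k. c * grow j f k)" for j f
    by (auto simp: grow_def avg_def algebra_simps)
  ultimately show ?thesis using assms by (simp add: lvl_def)
qed

lemma lvl_zero: "(\<lambda>k. 0) \<in> lvl n"
  by (simp add: lvl_def trunc_def grow_def avg_def fun_eq_iff)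

lemma lvl_sum: "(\<And>i. i \<in> I \<Longrightarrow> x i \<in> lvl n) \<Longrightarrow> (\<lambda>k. \<Sum>i\<in>I. x i k) \<in> lvl n"
  by (induction I rule: infinite_finite_induct) (auto simp: lvl_zero lvl_add)

lemma lvl_trunc_bound:
  assumes x: "x \<in> lvl n" and B: "\<And>k. norm (trunc n x k) \<le> B" and "n \<le> j"
  shows "norm (trunc j x k) \<le> B"
  using \<open>n \<le> j\<close>
proof (induction j arbitrary: k rule: dec_induct)
  case (step j)
  then show ?case using lvlD[OF x, of j] grow_bound[of j "trunc j x"] by simp
qed (rule B)

text \<open>Growth never increases the sup norm, so the norm of a function of level \<open>n\<close>
  is already attained on its window.\<close>

lemma lvl_bound:
  assumes x: "x \<in> lvl n" and B: "\<And>k. k \<in> win n \<Longrightarrow> norm (x k) \<le> B"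
  shows "norm (x k) \<le> B"
proof -
  let ?j = "n + nat \<bar>k\<bar>"
  have "0 \<in> win n" by (simp add: win_def)
  then have "B \<ge> 0" using B norm_ge_zero order_trans by blast
  then have "norm (trunc ?j x k) \<le> B"
    using B by (intro lvl_trunc_bound[OF x, of B "n + nat \<bar>k\<bar>" k]) (auto simp: trunc_def)
  then show ?thesis using eventually_in_win[of k ?j] by (simp add: trunc_def)
qed

lemma lvl_eqI:
  assumes "x \<in> lvl n" "y \<in> lvl n" "\<And>k. k \<in> win n \<Longrightarrow> x k = y k"
  shows "x = y"
proof
  fix k
  have "norm (x k + -1 * y k) \<le> 0"
    by (rule lvl_bound[OF lvl_add[OF assms(1) lvl_scale[OF assms(2), of "-1"]]])
      (simp add: assms(3))
  then show "x k = y k" by (metis add.right_inverse add_right_cancel mult_minus1 norm_le_zero_iff)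
qed

text \<open>Every edge of window \<open>j\<close> sits inside a wide zone of zeros. Its inner part
  comes from the end of the previous block, its outer part from the distance to the next one. This
  makes unit shifts harmless.\<close>

lemma lvl_gap:
  assumes x: "x \<in> lvl n" and j: "n < j" and k: "16 ^ j < \<bar>k\<bar>" "\<bar>k\<bar> < 5 * 16 ^ j"
  shows "x k = 0"
proof -
  have pos: "(16::int) ^ i > 0" for i by simp
  obtain i where i: "j = Suc i" "n \<le> i" using j by (cases j) auto
  show ?thesis
  proof (cases "k \<in> win j")
    case True
    then have "x k = grow i (trunc i x) k"
      using lvl_apply[OF x i(2)] i(1) by blast
    also have "\<dots> = 0"
      using k i pos[of i] by (intro grow_zero) auto
    finally show ?thesis .
  next
    case False
    then have k': "\<bar>k\<bar> > 4 * 16 ^ j" by (simp add: in_win_iff)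
    have "k \<in> win (Suc j)" using k pos[of j] by (simp add: in_win_iff)
    then have "x k = grow j (trunc j x) k"
      using lvl_apply[OF x, of j] j by simp
    also have "\<dots> = 0"
      using k k' pos[of j] by (intro grow_zero) auto
    finally show ?thesis .
  qed
qed

text \<open>Windowing before or after a unit shift differs only next to an edge of window
  \<open>j\<close>, and there \<open>x\<close> vanishes by \<open>lvl_gap\<close>.\<close>

lemma trunc_shift:
  assumes x: "x \<in> lvl n" and j: "n < j" and u: "\<bar>u\<bar> \<le> 1"
  shows "trunc j (\<lambda>k. x (k - u)) = (\<lambda>k. trunc j x (k - u))"
proof
  fix k
  have pos: "(16::int) ^ j \<ge> 1" by simp
  have "x (k - u) = 0" if "(k \<in> win j) \<noteq> (k - u \<in> win j)"
    using that u pos j power_increasing[of 1 j "16::int"] 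
    by (intro lvl_gap[OF x j]) (auto simp: in_win_iff)
  then show "trunc j (\<lambda>k. x (k - u)) k = trunc j x (k - u)"
    by (auto simp: trunc_def)
qed

text \<open>One level is lost because the zeros at the edge of window \<open>j\<close> are
  guaranteed only for \<open>j > n\<close>.\<close>

lemma lvl_shift:
  assumes x: "x \<in> lvl n" and u: "\<bar>u\<bar> \<le> 1"
  shows "(\<lambda>k. x (k - u)) \<in> lvl (Suc n)"
proof -
  have "grow j (\<lambda>k. f (k - u)) = (\<lambda>k. grow j f (k - u))" for j f
    by (auto simp: grow_def avg_def fun_eq_iff algebra_simps)
  then show ?thesis
    using lvlD[OF x] by (auto simp: lvl_def trunc_shift[OF x _ u])
qed

primrec grow_iter :: "nat \<Rightarrow> (int \<Rightarrow> complex) \<Rightarrow> nat \<Rightarrow> int \<Rightarrow> complex" where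
  "grow_iter n y 0 = y"
| "grow_iter n y (Suc m) = grow (n + m) (grow_iter n y m)"

text \<open>Repeated growth changes nothing on windows already built, so the iterates stabilise
  pointwise; the stable values form the extension.\<close>

lemma lvl_extension:
  assumes y: "trunc n y = y"
  obtains x where "x \<in> lvl n" "\<And>k. k \<in> win n \<Longrightarrow> x k = y k"
proof -
  have supp: "trunc (n + m) (grow_iter n y m) = grow_iter n y m" for m
    using y grow_support by (induction m) auto
  have stable: "grow_iter n y m' k = grow_iter n y m k" if k: "k \<in> win (n + m)" and "m \<le> m'" for k m m'
    using \<open>m \<le> m'\<close>
  proof (induction m' rule: dec_induct)
    case (step i)
    then have "k \<in> win (n + i)" using k win_mono[of "n + m" "n + i"] by auto
    then show ?case using step grow_low[OF supp] by (simp add: win_def)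
  qed simp
  \<comment> \<open>The number of iterations \<open>nat \<bar>k\<bar>\<close> is merely large enough
    for \<open>k\<close> to lie in the window reached.\<close>
  define x where "x k = grow_iter n y (nat \<bar>k\<bar>) k" for k
  have x: "x k = grow_iter n y m k" if k: "k \<in> win (n + m)" for k m
  proof -
    have "k \<in> win (n + nat \<bar>k\<bar>)" by (rule eventually_in_win) simp
    then show ?thesis
      using stable[OF k, of "max m (nat \<bar>k\<bar>)"] stable[of k "nat \<bar>k\<bar>" "max m (nat \<bar>k\<bar>)"]
      by (simp add: x_def)
  qed
  have tx: "trunc (n + m) x = grow_iter n y m" for m
  proof
    show "trunc (n + m) x k = grow_iter n y m k" for k
      using x[of k m] trunc_support[OF supp, of k m] by (simp add: trunc_def)
  qed
  have "trunc (Suc j) x = grow j (trunc j x)" if "n \<le> j" for j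
    using tx[of "j - n"] tx[of "Suc (j - n)"] that by simp
  then have "x \<in> lvl n" by (simp add: lvl_def)
  then show ?thesis using that[of x] x[of _ 0] by simp
qed

text \<open>A point between windows \<open>j\<close> and \<open>Suc j\<close> carries zero or an
  average taken with factor \<open>lam (col j)\<close>. For a colour above \<open>n\<close> the two
  averaged translates start out disjointly supported on window \<open>col j\<close>; their sum keeps
  norm at most 1 under growth, which leaves the factor 1/2.\<close>

lemma lvl_step_bound:
  assumes x: "x \<in> lvl n" and B: "\<And>k. norm (x k) \<le> 1" and j: "n \<le> j"
    and l: "l \<in> win (Suc j) - win j"
  shows "norm (x l) \<le> lam (col j)" "n < col j \<Longrightarrow> norm (x l) \<le> 1 / 2"
proof -
  let ?g = "\<lambda>j. trunc j x"
  have xl: "x l = grow j (?g j) l"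
    using lvl_apply[OF x j] l by blast
  have B': "norm (?g j k) \<le> 1" for j k using B by (simp add: trunc_def)
  have pos: "(16::int) ^ i > 0" for i by simp
  have xl_cases: "x l = 0 \<or> x l = avg (col j) (?g j) (l - tau j)"
  proof (cases "l > 4 * 16 ^ j")
    case False
    then have "l < - 4 * 16 ^ j" using l by (auto simp: in_win_iff)
    then show ?thesis using xl grow_zero[of j "?g j" l] by simp
  qed (use xl grow_high[of j "?g j" l] in simp)
  show "norm (x l) \<le> lam (col j)"
    using xl_cases
  proof
    assume "x l = 0"
    then show ?thesis using lam_bounds(1)[of "col j"] by simp
  next
    assume "x l = avg (col j) (?g j) (l - tau j)"
    then show ?thesis using avg_bound[of "?g j" _ 1] B' by simp
  qed
  show "norm (x l) \<le> 1 / 2" if i: "n < col j"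
  proof -
    define i where "i = col j"
    have ij: "n < i" "i \<le> j" using i col_le by (auto simp: i_def)
    let ?h = "\<lambda>m k. ?g m k + ?g m (k - gap i)"
    have zero: "?g m k = 0" if "i \<le> m" "\<bar>k\<bar> > 16 ^ m" for m k
      using lvl_gap[OF x, of m k] that ij pos[of m] by (auto simp: trunc_def in_win_iff)
    \<comment> \<open>The support radius \<open>16 ^ m\<close> plus a gap of at most
      \<open>3 * 16 ^ m\<close> is the half-width of window \<open>m\<close>: here the extra width
      of the windows is used.\<close>
    have supp: "trunc m (?h m) = ?h m" if "i \<le> m" for m
    proof -
      have gap: "0 < gap i" "gap i \<le> 3 * 16 ^ m"
        using that by (auto simp: gap_def power_increasing)
      have "?h m k = 0" if "k \<notin> win m" for k
        using zero[of m k] zero[of m "k - gap i"] \<open>i \<le> m\<close> that gap pos[of m]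
        by (auto simp: in_win_iff)
      then show ?thesis by (force simp: trunc_def)
    qed
    \<comment> \<open>The base \<open>m = i\<close> is disjointness of supports. In the step, growth
      commutes with translation and addition, so \<open>?h\<close> obeys the recursion of
      \<open>x\<close>.\<close>
    have "norm (?h m k) \<le> 1" if "i \<le> m" for m k
      using that
    proof (induction m arbitrary: k rule: dec_induct)
      case base
      have "16 ^ i < \<bar>k\<bar> \<or> 16 ^ i < \<bar>k - gap i\<bar>"
        using pos[of i] unfolding gap_def by linarith
      then have "?g i k = 0 \<or> ?g i (k - gap i) = 0"
        using zero[of i k] zero[of i "k - gap i"] by blast
      then show ?case using B'[of i] by auto
    next
      case (step m)
      have "?h (Suc m) k = grow m (?h m) k"
        using lvlD[OF x, of m] step ij by (simp add: grow_def avg_def algebra_simps)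
      then show ?case using grow_bound[OF supp[OF step(1)] step.IH] by simp
    qed
    then have h: "norm (?h j k) \<le> 1" for k using ij by blast
    show ?thesis
      using xl_cases
    proof
      assume xl: "x l = avg (col j) (?g j) (l - tau j)"
      have "norm (x l) = lam i / 2 * norm (?h j (l - tau j))"
        using lam_bounds(1)[of i] unfolding xl avg_def norm_mult norm_of_real i_def by simp
      also have "\<dots> \<le> 1 / 2 * 1"
        using h lam_bounds[of i] by (intro mult_mono) auto
      finally show ?thesis by simp
    qed simp
  qed
qed

text \<open>The basis of level \<open>n\<close> dual to the coordinates in window \<open>n\<close>;
  a choice exists by \<open>lvl_extension\<close> and is unique by \<open>lvl_eqI\<close> when
  \<open>k\<close> is in the window.\<close>

definition ext_unit :: "nat \<Rightarrow> int \<Rightarrow> int \<Rightarrow> complex" where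
  "ext_unit n k = (SOME x. x \<in> lvl n \<and> (\<forall>l\<in>win n. x l = of_bool (l = k)))"

lemma ext_unit:
  shows "ext_unit n k \<in> lvl n" "l \<in> win n \<Longrightarrow> ext_unit n k l = of_bool (l = k)"
proof -
  obtain x where "x \<in> lvl n" "\<And>l. l \<in> win n \<Longrightarrow> x l = trunc n (\<lambda>l. of_bool (l = k)) l"
    using lvl_extension[of n "trunc n (\<lambda>l. of_bool (l = k))"] by auto
  then have "x \<in> lvl n \<and> (\<forall>l\<in>win n. x l = of_bool (l = k))" by (auto simp: trunc_def)
  then have "ext_unit n k \<in> lvl n \<and> (\<forall>l\<in>win n. ext_unit n k l = of_bool (l = k))"
    unfolding ext_unit_def by (rule someI[of "\<lambda>x. x \<in> lvl n \<and> (\<forall>l\<in>win n. x l = of_bool (l = k))"])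
  then show "ext_unit n k \<in> lvl n" "l \<in> win n \<Longrightarrow> ext_unit n k l = of_bool (l = k)" by auto
qed

lemma lvl_expansion:
  assumes "x \<in> lvl n"
  shows "x = (\<lambda>l. \<Sum>k\<in>win n. x k * ext_unit n k l)"
  by (rule lvl_eqI[OF assms]) (auto intro!: lvl_sum lvl_scale simp: ext_unit if_distrib of_bool_def cong: if_cong)

section \<open>The uniform closure of the levels: closedness and shift invariance\<close>

definition block_space :: "(int \<Rightarrow> complex) set" where
  "block_space = {x. \<forall>\<epsilon>>0. \<exists>n. \<exists>v\<in>lvl n. \<forall>k. norm (x k - v k) \<le> \<epsilon>}"

lemma block_spaceE:
  assumes "x \<in> block_space" "\<epsilon> > 0"
  obtains n v where "v \<in> lvl n" "\<And>k. norm (x k - v k) \<le> \<epsilon>"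
  using assms by (auto simp: block_space_def)

lemma lvl_subset_block_space: "lvl n \<subseteq> block_space"
  by (force simp: block_space_def)

lemma lvl_subset_l_inf: "lvl n \<subseteq> l_inf"
proof
  fix x assume x: "x \<in> lvl n"
  show "x \<in> l_inf"
    by (rule l_infI, rule lvl_bound[OF x, where B = "\<Sum>k\<in>win n. norm (x k)"])
      (rule member_le_sum, auto)
qed

lemma block_space_subset_l_inf: "block_space \<subseteq> l_inf"
proof
  fix x assume "x \<in> block_space"
  then obtain n v where v: "v \<in> lvl n" "\<And>k. norm (x k - v k) \<le> 1"
    using block_spaceE[of x 1] zero_less_one by metis
  have "norm (x k) \<le> 1 + sup_norm v" for k
    using v(2)[of k] norm_le_sup_norm[of v k] v(1) lvl_subset_l_inf norm_triangle_sub[of "x k" "v k"]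
    by fastforce
  then show "x \<in> l_inf" by (rule l_infI)
qed

lemma complex_subspace_block_space: "complex_subspace block_space"
  unfolding complex_subspace_def
proof (intro conjI ballI allI)
  show "(\<lambda>i. 0) \<in> block_space" using lvl_zero lvl_subset_block_space by blast
  fix x assume x: "x \<in> block_space"
  show "(\<lambda>i. c * x i) \<in> block_space" for c
    unfolding block_space_def
  proof (intro CollectI allI impI)
    fix \<epsilon> :: real assume \<epsilon>: "\<epsilon> > 0"
    have pos: "norm c + 1 > 0" by (simp add: add_nonneg_pos)
    then have "\<epsilon> / (norm c + 1) > 0" using \<epsilon> by simp
    then obtain n v where v: "v \<in> lvl n" "\<And>k. norm (x k - v k) \<le> \<epsilon> / (norm c + 1)"
      using block_spaceE[OF x] by metis
    have "norm (c * x k - c * v k) \<le> \<epsilon>" for k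
    proof -
      have "norm (c * x k - c * v k) = norm c * norm (x k - v k)"
        by (metis norm_mult right_diff_distrib)
      also have "\<dots> \<le> (norm c + 1) * (\<epsilon> / (norm c + 1))"
        using v(2) by (intro mult_mono) auto
      also have "\<dots> = \<epsilon>" using pos by simp
      finally show ?thesis .
    qed
    then show "\<exists>n. \<exists>v\<in>lvl n. \<forall>k. norm (c * x k - v k) \<le> \<epsilon>"
      using lvl_scale[OF v(1), of c] by (intro exI[of _ n] bexI[of _ "\<lambda>k. c * v k"]) auto
  qed
  fix y assume y: "y \<in> block_space"
  show "(\<lambda>i. x i + y i) \<in> block_space"
    unfolding block_space_def
  proof (intro CollectI allI impI)
    fix \<epsilon> :: real assume "\<epsilon> > 0"
    then have \<epsilon>: "\<epsilon> / 2 > 0" by simp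
    obtain n v where v: "v \<in> lvl n" "\<And>k. norm (x k - v k) \<le> \<epsilon> / 2" using block_spaceE[OF x \<epsilon>] by blast
    obtain m w where w: "w \<in> lvl m" "\<And>k. norm (y k - w k) \<le> \<epsilon> / 2" using block_spaceE[OF y \<epsilon>] by blast
    have "(\<lambda>k. v k + w k) \<in> lvl (max m n)"
      using v w lvl_mono[of n "max m n"] lvl_mono[of m "max m n"] by (intro lvl_add) auto
    moreover have "norm (x k + y k - (v k + w k)) \<le> \<epsilon>" for k
      using norm_triangle_ineq[of "x k - v k" "y k - w k"] v(2)[of k] w(2)[of k]
      by (simp add: algebra_simps)
    ultimately show "\<exists>n. \<exists>v\<in>lvl n. \<forall>k. norm (x k + y k - v k) \<le> \<epsilon>"
      by (intro exI[of _ "max m n"] bexI[of _ "\<lambda>k. v k + w k"]) auto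
  qed
qed

lemma closedin_block_space: "closedin (norm_topology l_inf sup_norm) block_space"
proof -
  interpret fun_normed_space "l_inf :: (int \<Rightarrow> complex) set" sup_norm
    by (rule fun_normed_space_sup_norm[OF complex_subspace_l_inf order_refl])
  show ?thesis
    unfolding norm_topology_def closedin_metric
  proof (intro conjI allI impI block_space_subset_l_inf)
    fix x :: "int \<Rightarrow> complex" assume x: "x \<in> l_inf - block_space"
    then obtain \<epsilon> where \<epsilon>: "\<epsilon> > 0" "\<And>n v. v \<in> lvl n \<Longrightarrow> \<exists>k. \<not> norm (x k - v k) \<le> \<epsilon>"
      by (auto simp: block_space_def)
    have "y \<notin> mball x (\<epsilon> / 2)" if y: "y \<in> block_space" for y
    proof
      assume "y \<in> mball x (\<epsilon> / 2)"
      then have d: "sup_norm (\<lambda>i. x i - y i) < \<epsilon> / 2" "y \<in> l_inf"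
        by (auto simp: norm_dist_def)
      have "\<epsilon> / 2 > 0" using \<epsilon> by simp
      then obtain n v where v: "v \<in> lvl n" "\<And>k. norm (y k - v k) \<le> \<epsilon> / 2" using block_spaceE[OF y] by blast
      have "norm (x k - v k) \<le> \<epsilon>" for k
        using norm_triangle_ineq[of "x k - y k" "y k - v k"] v(2)[of k] d
          norm_le_sup_norm[OF diff_mem[of x y], of k] x by simp
      then show False using \<epsilon>(2)[OF v(1)] by blast
    qed
    then show "\<exists>r>0. disjnt block_space (mball x r)"
      using \<epsilon> by (intro exI[of _ "\<epsilon> / 2"]) (auto simp: disjnt_def)
  qed
qed

lemma block_space_shift:
  assumes x: "x \<in> block_space" and u: "\<bar>u\<bar> \<le> 1"
  shows "(\<lambda>k. x (k - u)) \<in> block_space"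
  unfolding block_space_def
proof (intro CollectI allI impI)
  fix \<epsilon> :: real assume "\<epsilon> > 0"
  then obtain n v where v: "v \<in> lvl n" "\<And>k. norm (x k - v k) \<le> \<epsilon>" using block_spaceE[OF x] by blast
  show "\<exists>n. \<exists>v\<in>lvl n. \<forall>k. norm (x (k - u) - v k) \<le> \<epsilon>"
    using lvl_shift[OF v(1) u] v(2)
    by (intro exI[of _ "Suc n"] bexI[of _ "\<lambda>k. v (k - u)"]) auto
qed

lemma bilateral_shift_block_space: "bilateral_shift ` block_space = block_space"
proof
  show "bilateral_shift ` block_space \<subseteq> block_space"
    using block_space_shift[of _ 1] by (auto simp: bilateral_shift_def)
  show "block_space \<subseteq> bilateral_shift ` block_space"
  proof
    fix x assume "x \<in> block_space"
    then have "(\<lambda>k. x (k + 1)) \<in> block_space" using block_space_shift[of x "-1"] by simp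
    then show "x \<in> bilateral_shift ` block_space"
      by (rule rev_image_eqI) (simp add: bilateral_shift_def)
  qed
qed

section \<open>Duality with \<open>\<ell>\<^sub>1(\<int>)\<close>\<close>

text \<open>Extends the conjugate signs of \<open>a\<close> on the window; the extension keeps norm
  at most 1.\<close>

lemma lvl_norming:
  fixes a :: "int \<Rightarrow> complex"
  obtains x where "x \<in> lvl n" "\<And>k. norm (x k) \<le> 1" "\<And>k. k \<in> win n \<Longrightarrow> x k * a k = norm (a k)"
proof -
  obtain x where x: "x \<in> lvl n" "\<And>k. k \<in> win n \<Longrightarrow> x k = trunc n (\<lambda>k. cnj (sgn (a k))) k"
    using lvl_extension[of n "trunc n (\<lambda>k. cnj (sgn (a k)))"] by auto
  show ?thesis
  proof
    show "norm (x k) \<le> 1" for k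
      by (rule lvl_bound[OF x(1)]) (simp add: x(2) trunc_def norm_sgn)
    show "x k * a k = norm (a k)" if "k \<in> win n" for k
    proof (cases "a k = 0")
      case False
      have "x k = cnj (a k) / norm (a k)"
        using that x(2)[OF that] by (simp add: trunc_def sgn_div_norm scaleR_conv_of_real divide_inverse)
      then have "x k * a k = (a k * cnj (a k)) / norm (a k)" by simp
      also have "\<dots> = norm (a k)"
        using False by (simp add: complex_norm_square[symmetric] power2_eq_square)
      finally show ?thesis .
    qed (use that x in simp)
  qed (rule x)
qed

lemma block_space_norm_le: "x \<in> block_space \<Longrightarrow> norm (x k) \<le> sup_norm x"
  using norm_le_sup_norm[of x k] subsetD[OF block_space_subset_l_inf] by blast

section \<open>Coefficients of a functional on the levels\<close>

locale block_functional =
  fixes \<phi> :: "(int \<Rightarrow> complex) \<Rightarrow> complex" and C :: real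
  assumes dual: "\<phi> \<in> dual_space block_space" and C_nonneg: "C \<ge> 0"
    and bound: "x \<in> block_space \<Longrightarrow> norm (\<phi> x) \<le> C * sup_norm x"
begin

lemma phi_add: "x \<in> block_space \<Longrightarrow> y \<in> block_space \<Longrightarrow> \<phi> (\<lambda>i. x i + y i) = \<phi> x + \<phi> y"
  and phi_scale: "x \<in> block_space \<Longrightarrow> \<phi> (\<lambda>i. c * x i) = c * \<phi> x"
  using dual unfolding dual_space_def by blast+

lemma phi_zero: "\<phi> (\<lambda>i. 0) = 0"
  using phi_scale[of "\<lambda>i. 0" 0] lvl_zero lvl_subset_block_space by auto

lemma phi_sum:
  "(\<And>i. i \<in> I \<Longrightarrow> x i \<in> lvl n) \<Longrightarrow> \<phi> (\<lambda>k. \<Sum>i\<in>I. x i k) = (\<Sum>i\<in>I. \<phi> (x i))"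
proof (induction I rule: infinite_finite_induct)
  case (insert i I)
  have "x i \<in> block_space" "(\<lambda>k. \<Sum>i\<in>I. x i k) \<in> block_space"
    using insert.prems lvl_sum[of I x n] lvl_subset_block_space by auto
  then show ?case using insert phi_add by simp
qed (auto simp: phi_zero)

definition coef :: "nat \<Rightarrow> int \<Rightarrow> complex" where "coef n k = \<phi> (ext_unit n k)"

text \<open>The norm of the restriction of \<open>\<phi>\<close> to level \<open>n\<close>, as that
  level is isometric to the functions on window \<open>n\<close> with the sup norm.\<close>

definition mass :: "nat \<Rightarrow> real" where "mass n = (\<Sum>k\<in>win n. norm (coef n k))"

lemma phi_lvl:
  assumes "x \<in> lvl n" "n \<le> q"
  shows "\<phi> x = (\<Sum>k\<in>win q. x k * coef q k)"
proof -
  have x: "x \<in> lvl q" using assms lvl_mono by blast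
  have "\<phi> x = (\<Sum>k\<in>win q. \<phi> (\<lambda>l. x k * ext_unit q k l))"
    by (subst lvl_expansion[OF x], rule phi_sum) (rule lvl_scale, rule ext_unit)
  also have "\<dots> = (\<Sum>k\<in>win q. x k * coef q k)"
    using ext_unit(1) lvl_subset_block_space unfolding coef_def by (intro sum.cong refl phi_scale) blast
  finally show ?thesis .
qed

lemma lvl_norming_mass:
  obtains x where "x \<in> lvl n" "\<And>k. norm (x k) \<le> 1" "\<phi> x = mass n"
proof -
  obtain x where x: "x \<in> lvl n" "\<And>k. norm (x k) \<le> 1"
    "\<And>k. k \<in> win n \<Longrightarrow> x k * coef n k = norm (coef n k)"
    by (rule lvl_norming[of n "coef n"]) blast
  have "\<phi> x = mass n" using phi_lvl[OF x(1) order_refl] x(3) by (simp add: mass_def)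
  then show ?thesis using that x(1,2) by blast
qed

lemma mass_le: "mass n \<le> C"
proof -
  obtain x where x: "x \<in> lvl n" "\<And>k. norm (x k) \<le> 1" "\<phi> x = mass n"
    by (rule lvl_norming_mass) blast
  have "norm (\<phi> x) \<le> C * sup_norm x" using x lvl_subset_block_space by (intro bound) blast
  also have "\<dots> \<le> C * 1" using C_nonneg x by (intro mult_left_mono sup_norm_le) auto
  finally show ?thesis using x(3) by simp
qed

text \<open>A norming function of level \<open>n\<close> is also a competitor at level
  \<open>q\<close>. Wherever it falls short of 1 by \<open>\<delta>\<close>, the coefficients of
  level \<open>q\<close> are undercounted by that proportion, and the total shortfall is at most the
  increase of mass.\<close>

lemma mass_loss:
  assumes "n \<le> q" "x \<in> lvl n" "\<And>k. norm (x k) \<le> 1" "\<phi> x = mass n"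
    and R: "R \<subseteq> win q" "\<And>k. k \<in> R \<Longrightarrow> norm (x k) \<le> 1 - \<delta>"
  shows "\<delta> * (\<Sum>k\<in>R. norm (coef q k)) \<le> mass q - mass n"
proof -
  have "mass n = norm (\<phi> x)" using assms(4) by (simp add: mass_def sum_nonneg del: of_real_sum)
  also have "\<dots> \<le> (\<Sum>k\<in>win q. norm (x k * coef q k))"
    unfolding phi_lvl[OF assms(2,1)] by (rule norm_sum)
  also have "\<dots> = (\<Sum>k\<in>win q - R. norm (x k) * norm (coef q k)) + (\<Sum>k\<in>R. norm (x k) * norm (coef q k))"
    using R by (simp add: norm_mult sum.subset_diff)
  also have "\<dots> \<le> (\<Sum>k\<in>win q - R. 1 * norm (coef q k)) + (\<Sum>k\<in>R. (1 - \<delta>) * norm (coef q k))"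
    using assms(3) R by (intro add_mono sum_mono mult_right_mono) auto
  also have "\<dots> = mass q - \<delta> * (\<Sum>k\<in>R. norm (coef q k))"
    using R by (simp add: mass_def sum.subset_diff[of R "win q"] algebra_simps sum_subtractf sum_distrib_left)
  finally show ?thesis by simp
qed

lemma mass_mono: "n \<le> q \<Longrightarrow> mass n \<le> mass q"
proof -
  assume "n \<le> q"
  obtain x where x: "x \<in> lvl n" "\<And>k. norm (x k) \<le> 1" "\<phi> x = mass n"
    by (rule lvl_norming_mass) blast
  show ?thesis using mass_loss[OF \<open>n \<le> q\<close> x, of "{}" 0] by simp
qed

lemma mass_convergent: "mass \<longlonglongrightarrow> (SUP n. mass n)"
  by (rule LIMSEQ_incseq_SUP) (auto intro!: bdd_aboveI2[of _ _ C] mass_le mass_mono simp: mono_def)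

lemma mass_le_SUP: "mass n \<le> (SUP n. mass n)"
  by (rule cSUP_upper) (auto intro!: bdd_aboveI2[of _ _ C] mass_le)

text \<open>
  Beyond the window \<open>p\<close>, a unit vector of level \<open>p\<close> is at most \<open>lam i\<close> on blocks of colour \<open>i\<close>,
  and a unit vector of level \<open>n\<close> is at most \<open>1/2\<close> on blocks of colour \<open>> n\<close>. The first fact is used
  for the finitely many colours \<open>\<le> n\<close> and the second one for the others.
\<close>

lemma outside_mass:
  assumes "n \<le> p" "p \<le> q"
  shows "(\<Sum>k\<in>win q - win p. norm (coef q k))
    \<le> 2 * ((SUP n. mass n) - mass n) + ((SUP n. mass n) - mass p) / (1 - lam n)"
proof -
  define R where "R = {l \<in> win q - win p. \<exists>j\<ge>p. l \<in> win (Suc j) - win j \<and> n < col j}"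
  define R' where "R' = {l \<in> win q - win p. \<exists>j\<ge>p. l \<in> win (Suc j) - win j \<and> col j \<le> n}"
  have "win q - win p \<subseteq> R \<union> R'"
  proof
    fix l assume l: "l \<in> win q - win p"
    \<comment> \<open>The first window containing \<open>l\<close> identifies the block index
      \<open>j\<close> as its predecessor.\<close>
    define m where "m = (LEAST m. l \<in> win m)"
    have m: "l \<in> win m" using l LeastI[of "\<lambda>m. l \<in> win m" q] unfolding m_def by blast
    have "\<not> m \<le> p" using m l win_mono by blast
    then obtain j where j: "m = Suc j" "p \<le> j" by (cases m) auto
    have "l \<notin> win j" using not_less_Least[of j "\<lambda>m. l \<in> win m"] j by (simp add: m_def)
    then have "p \<le> j \<and> l \<in> win (Suc j) - win j" using m j by blast
    then show "l \<in> R \<union> R'" using l unfolding R_def R'_def by (cases "n < col j") (auto simp: not_less)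
  qed
  then have "(\<Sum>k\<in>win q - win p. norm (coef q k)) \<le> (\<Sum>k\<in>R \<union> R'. norm (coef q k))"
    by (intro sum_mono2) (auto simp: R_def R'_def)
  also have "\<dots> \<le> (\<Sum>k\<in>R. norm (coef q k)) + (\<Sum>k\<in>R'. norm (coef q k))"
    by (subst sum.union_inter[symmetric]) (auto simp: R_def R'_def sum_nonneg)
  finally have split: "(\<Sum>k\<in>win q - win p. norm (coef q k))
    \<le> (\<Sum>k\<in>R. norm (coef q k)) + (\<Sum>k\<in>R'. norm (coef q k))" .
  obtain x where x: "x \<in> lvl n" "\<And>k. norm (x k) \<le> 1" "\<phi> x = mass n"
    by (rule lvl_norming_mass) blast
  have "norm (x k) \<le> 1 - 1 / 2" if k: "k \<in> R" for k
  proof -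
    obtain j where "p \<le> j" "k \<in> win (Suc j) - win j" "n < col j" using k by (auto simp: R_def)
    then show ?thesis using lvl_step_bound(2)[OF x(1,2), of j k] assms by simp
  qed
  then have "1 / 2 * (\<Sum>k\<in>R. norm (coef q k)) \<le> mass q - mass n"
    using assms by (intro mass_loss[OF _ x]) (auto simp: R_def)
  then have "(\<Sum>k\<in>R. norm (coef q k)) \<le> 2 * (mass q - mass n)" by simp
  also have "\<dots> \<le> 2 * ((SUP n. mass n) - mass n)" using mass_le_SUP[of q] by simp
  finally have 1: "(\<Sum>k\<in>R. norm (coef q k)) \<le> 2 * ((SUP n. mass n) - mass n)" .
  obtain y where y: "y \<in> lvl p" "\<And>k. norm (y k) \<le> 1" "\<phi> y = mass p"
    by (rule lvl_norming_mass) blast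
  have "norm (y k) \<le> 1 - (1 - lam n)" if k: "k \<in> R'" for k
  proof -
    obtain j where "p \<le> j" "k \<in> win (Suc j) - win j" "col j \<le> n" using k by (auto simp: R'_def)
    then show ?thesis using lvl_step_bound(1)[OF y(1,2), of j k] lam_mono[of "col j" n] by simp
  qed
  then have "(1 - lam n) * (\<Sum>k\<in>R'. norm (coef q k)) \<le> mass q - mass p"
    using assms by (intro mass_loss[OF _ y]) (auto simp: R'_def)
  then have "(1 - lam n) * (\<Sum>k\<in>R'. norm (coef q k)) \<le> (SUP n. mass n) - mass p"
    using mass_le_SUP[of q] by linarith
  then have "(\<Sum>k\<in>R'. norm (coef q k)) \<le> ((SUP n. mass n) - mass p) / (1 - lam n)"
    using lam_bounds(2)[of n] by (simp add: field_simps)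
  with 1 split show ?thesis by linarith
qed

text \<open>No mass escapes to infinity, uniformly in \<open>q\<close>. The order of choice matters:
  \<open>n\<close> first makes the term for large colours small, and only then, with
  \<open>1 - lam n\<close> fixed, is \<open>p\<close> taken so large that the remaining increase of
  mass is small compared to it.\<close>

lemma outside_mass_small:
  assumes "\<epsilon> > 0"
  obtains p where "\<And>r q. p \<le> r \<Longrightarrow> r \<le> q \<Longrightarrow> (\<Sum>k\<in>win q - win r. norm (coef q k)) \<le> \<epsilon>"
proof -
  let ?L = "SUP n. mass n"
  have "eventually (\<lambda>n. mass n > ?L - \<epsilon> / 4) sequentially"
    using order_tendstoD(1)[OF mass_convergent, of "?L - \<epsilon> / 4"] assms by simp
  then obtain n where n: "?L - mass n < \<epsilon> / 4"
    unfolding eventually_sequentially by (metis less_diff_eq diff_less_eq add.commute order_refl)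
  have \<lambda>: "1 - lam n > 0" using lam_bounds(2)[of n] by simp
  then have "eventually (\<lambda>p. mass p > ?L - \<epsilon> / 2 * (1 - lam n)) sequentially"
    using order_tendstoD(1)[OF mass_convergent, of "?L - \<epsilon> / 2 * (1 - lam n)"] assms by simp
  then obtain p where p: "\<And>r. r \<ge> p \<Longrightarrow> mass r > ?L - \<epsilon> / 2 * (1 - lam n)"
    unfolding eventually_sequentially by blast
  show ?thesis
  proof (rule that[of "max n p"])
    fix r q assume r: "max n p \<le> r" and q: "r \<le> q"
    have "?L - mass r \<le> \<epsilon> / 2 * (1 - lam n)" using p[of r] r by simp
    then have "(?L - mass r) / (1 - lam n) \<le> \<epsilon> / 2" using \<lambda> by (simp add: divide_le_eq)
    then have "(\<Sum>k\<in>win q - win r. norm (coef q k)) \<le> 2 * (?L - mass n) + \<epsilon> / 2"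
      using outside_mass[of n r q] r q by (meson add_left_mono max.boundedE order_trans)
    then show "(\<Sum>k\<in>win q - win r. norm (coef q k)) \<le> \<epsilon>" using n by argo
  qed
qed

lemma phi_window:
  assumes x: "x \<in> lvl n" and B: "\<And>k. norm (x k) \<le> B" and "n \<le> q" "r \<le> q"
    and \<epsilon>: "(\<Sum>k\<in>win q - win r. norm (coef q k)) \<le> \<epsilon>"
  shows "norm (\<phi> x - (\<Sum>k\<in>win r. x k * coef q k)) \<le> B * \<epsilon>"
proof -
  have "B \<ge> 0" using B[of 0] norm_ge_zero order_trans by blast
  have "\<phi> x - (\<Sum>k\<in>win r. x k * coef q k) = (\<Sum>k\<in>win q - win r. x k * coef q k)"
    unfolding phi_lvl[OF x \<open>n \<le> q\<close>]
    by (subst sum.subset_diff[OF win_mono[OF \<open>r \<le> q\<close>]]) auto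
  also have "norm \<dots> \<le> (\<Sum>k\<in>win q - win r. B * norm (coef q k))"
    using B by (intro sum_norm_le) (simp add: norm_mult mult_right_mono)
  also have "\<dots> \<le> B * \<epsilon>"
    using \<epsilon> \<open>B \<ge> 0\<close> by (simp add: sum_distrib_left[symmetric] mult_left_mono)
  finally show ?thesis .
qed

text \<open>Expanding \<open>ext_unit p k\<close> at level \<open>q\<close> gives
  \<open>coef q k\<close> from window \<open>p\<close>, since inside that window only the entry at
  \<open>k\<close> survives; the rest is bounded by the small mass outside.\<close>

lemma coef_convergent: "convergent (\<lambda>q. coef q k)"
  unfolding Cauchy_convergent_iff[symmetric]
proof (rule metric_CauchyI)
  fix \<epsilon> :: real assume "\<epsilon> > 0"
  then have "\<epsilon> / 3 > 0" by simp
  then obtain p0 where p0: "\<And>r q. p0 \<le> r \<Longrightarrow> r \<le> q \<Longrightarrow> (\<Sum>k\<in>win q - win r. norm (coef q k)) \<le> \<epsilon> / 3"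
    using outside_mass_small by blast
  define p where "p = max p0 (nat \<bar>k\<bar>)"
  have k: "k \<in> win p" by (rule eventually_in_win) (simp add: p_def)
  have e1: "norm (ext_unit p k l) \<le> 1" for l
    by (rule lvl_bound[OF ext_unit(1)]) (simp add: ext_unit(2))
  have close: "norm (coef p k - coef q k) \<le> \<epsilon> / 3" if "p \<le> q" for q
  proof -
    have "(\<Sum>l\<in>win p. ext_unit p k l * coef q l) = (\<Sum>l\<in>win p. of_bool (l = k) * coef q l)"
      by (intro sum.cong) (auto simp: ext_unit(2))
    also have "\<dots> = coef q k"
      using k by (simp add: of_bool_def if_distrib[of "\<lambda>c. c * _"] cong: if_cong)
    finally show ?thesis
      using phi_window[OF ext_unit(1) e1 that that, of "\<epsilon> / 3"] p0[of p q] that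
      by (simp add: coef_def p_def)
  qed
  have "dist (coef m k) (coef q k) < \<epsilon>" if "m \<ge> p" "q \<ge> p" for m q
    using close[OF that(1)] close[OF that(2)] dist_triangle3[of "coef m k" "coef q k" "coef p k"] \<open>\<epsilon> > 0\<close>
    by (simp add: dist_norm)
  then show "\<exists>M. \<forall>m\<ge>M. \<forall>n\<ge>M. dist (coef m k) (coef n k) < \<epsilon>" by blast
qed

definition limit_coef :: "int \<Rightarrow> complex" where "limit_coef k = lim (\<lambda>q. coef q k)"

lemma coef_tendsto: "(\<lambda>q. coef q k) \<longlonglongrightarrow> limit_coef k"
  using coef_convergent[of k] by (simp add: limit_coef_def convergent_LIMSEQ_iff)

text \<open>Each finite set lies in all late windows, so its partial sums are at most
  \<open>mass q\<close>, hence at most \<open>C\<close>.\<close>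

lemma limit_coef_l_one: "limit_coef \<in> l_one"
  unfolding l_one_def mem_Collect_eq
proof (rule nonneg_bdd_above_summable_on)
  have "(\<Sum>k\<in>F. norm (limit_coef k)) \<le> C" if F: "finite F" for F
  proof (rule tendsto_upperbound)
    show "(\<lambda>q. \<Sum>k\<in>F. norm (coef q k)) \<longlonglongrightarrow> (\<Sum>k\<in>F. norm (limit_coef k))"
      by (intro tendsto_sum tendsto_norm coef_tendsto)
    have "(\<Sum>k\<in>F. norm (coef q k)) \<le> C" if "q \<ge> (\<Sum>k\<in>F. nat \<bar>k\<bar>)" for q
    proof -
      have "nat \<bar>k\<bar> \<le> q" if "k \<in> F" for k
        using member_le_sum[of k F "\<lambda>k. nat \<bar>k\<bar>"] that F \<open>q \<ge> _\<close> by simp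
      then have "F \<subseteq> win q" using eventually_in_win by blast
      then have "(\<Sum>k\<in>F. norm (coef q k)) \<le> mass q"
        unfolding mass_def by (intro sum_mono2) auto
      then show ?thesis using mass_le[of q] by linarith
    qed
    then show "eventually (\<lambda>q. (\<Sum>k\<in>F. norm (coef q k)) \<le> C) sequentially"
      unfolding eventually_sequentially by blast
  qed simp
  then show "bdd_above (sum (\<lambda>n. norm (limit_coef n)) ` {F. F \<subseteq> UNIV \<and> finite F})"
    by (auto intro!: bdd_aboveI2[of _ _ C])
qed auto

end

section \<open>Summation along windows and representation of functionals\<close>

lemma filterlim_win: "filterlim win (finite_subsets_at_top UNIV) sequentially"
  unfolding filterlim_finite_subsets_at_top
proof (intro allI impI)
  fix F :: "int set" assume F: "finite F \<and> F \<subseteq> UNIV"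
  have "F \<subseteq> win q" if "q \<ge> (\<Sum>k\<in>F. nat \<bar>k\<bar>)" for q
  proof
    fix k assume "k \<in> F"
    then have "nat \<bar>k\<bar> \<le> q"
      using member_le_sum[of k F "\<lambda>k. nat \<bar>k\<bar>"] F that by simp
    then show "k \<in> win q" by (rule eventually_in_win)
  qed
  then show "eventually (\<lambda>q. finite (win q) \<and> F \<subseteq> win q \<and> win q \<subseteq> UNIV) sequentially"
    unfolding eventually_sequentially by auto
qed

lemma pairing_abs_summable:
  assumes "a \<in> l_one" "\<And>k. norm (x k) \<le> B"
  shows "(\<lambda>k. x k * a k) summable_on UNIV" "norm (\<Sum>\<^sub>\<infinity>k. x k * a k) \<le> B * l_one_norm a"
proof -
  have s: "(\<lambda>k. B * norm (a k)) summable_on UNIV"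
    using assms(1) by (intro summable_on_cmult_right) (simp add: l_one_def)
  then have abs: "(\<lambda>k. norm (x k * a k)) summable_on UNIV"
    using assms(2) by (rule_tac summable_on_comparison_test) (auto simp: norm_mult mult_right_mono)
  then show "(\<lambda>k. x k * a k) summable_on UNIV"
    by (rule abs_summable_summable)
  have "norm (\<Sum>\<^sub>\<infinity>k. x k * a k) \<le> (\<Sum>\<^sub>\<infinity>k. norm (x k * a k))"
    using abs by (rule norm_infsum_bound)
  also have "\<dots> \<le> (\<Sum>\<^sub>\<infinity>k. B * norm (a k))"
    using abs s assms(2) by (intro infsum_mono) (auto simp: norm_mult mult_right_mono)
  finally show "norm (\<Sum>\<^sub>\<infinity>k. x k * a k) \<le> B * l_one_norm a"
    by (simp add: l_one_norm_def infsum_cmult_right')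
qed

lemma pairing_window_limit:
  assumes "a \<in> l_one" "\<And>k. norm (x k) \<le> B"
  shows "(\<lambda>r. \<Sum>k\<in>win r. x k * a k) \<longlonglongrightarrow> (\<Sum>\<^sub>\<infinity>k. x k * a k)"
  using filterlim_compose[OF has_sum_infsum[OF pairing_abs_summable(1)[OF assms], unfolded has_sum_def] filterlim_win] .

context block_functional
begin

text \<open>For fixed large \<open>r\<close> the error outside window \<open>r\<close> is small for
  every late \<open>q\<close>. Letting \<open>q\<close> tend to infinity replaces the coefficients
  by their limits, and \<open>r\<close> is sent to infinity last.\<close>

lemma phi_lvl_limit:
  assumes x: "x \<in> lvl n"
  shows "\<phi> x = (\<Sum>\<^sub>\<infinity>k. x k * limit_coef k)"
proof -
  have B: "norm (x k) \<le> sup_norm x" for k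
    using block_space_norm_le subsetD[OF lvl_subset_block_space x] .
  define M where "M = sup_norm x + 1"
  have B': "norm (x k) \<le> M" for k using B[of k] by (simp add: M_def)
  have Bpos: "M > 0" using B[of 0] norm_ge_zero[of "x 0"] unfolding M_def by linarith
  have "(\<lambda>r. \<Sum>k\<in>win r. x k * limit_coef k) \<longlonglongrightarrow> \<phi> x"
  proof (rule LIMSEQ_I)
    fix \<epsilon> :: real assume "\<epsilon> > 0"
    then have "\<epsilon> / (2 * M) > 0" using Bpos by simp
    then obtain p where p: "\<And>r q. p \<le> r \<Longrightarrow> r \<le> q \<Longrightarrow> (\<Sum>k\<in>win q - win r. norm (coef q k)) \<le> \<epsilon> / (2 * M)"
      using outside_mass_small by blast
    have "norm ((\<Sum>k\<in>win r. x k * limit_coef k) - \<phi> x) < \<epsilon>" if r: "r \<ge> p" for r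
    proof -
      have "norm (\<phi> x - (\<Sum>k\<in>win r. x k * limit_coef k)) \<le> \<epsilon> / 2"
      proof (rule tendsto_upperbound)
        show "(\<lambda>q. norm (\<phi> x - (\<Sum>k\<in>win r. x k * coef q k)))
            \<longlonglongrightarrow> norm (\<phi> x - (\<Sum>k\<in>win r. x k * limit_coef k))"
          by (intro tendsto_intros coef_tendsto)
        have "norm (\<phi> x - (\<Sum>k\<in>win r. x k * coef q k)) \<le> \<epsilon> / 2" if "q \<ge> max n r" for q
        proof -
          have "M * (\<epsilon> / (2 * M)) = \<epsilon> / 2" using Bpos by simp
          then show ?thesis
            using phi_window[OF x B', of q r "\<epsilon> / (2 * M)"] p[of r q] that r by simp
        qed
        then show "eventually (\<lambda>q. norm (\<phi> x - (\<Sum>k\<in>win r. x k * coef q k)) \<le> \<epsilon> / 2) sequentially"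
          unfolding eventually_sequentially by blast
      qed simp
      then show ?thesis using \<open>\<epsilon> > 0\<close> by (simp add: norm_minus_commute)
    qed
    then show "\<exists>N. \<forall>r\<ge>N. norm ((\<Sum>k\<in>win r. x k * limit_coef k) - \<phi> x) < \<epsilon>" by blast
  qed
  then show ?thesis
    by (rule LIMSEQ_unique[OF _ pairing_window_limit[OF limit_coef_l_one B]])
qed

text \<open>Both sides are bounded linear functionals agreeing on the levels, which are
  dense.\<close>

lemma phi_block_space_limit:
  assumes x: "x \<in> block_space"
  shows "\<phi> x = (\<Sum>\<^sub>\<infinity>k. x k * limit_coef k)"
proof -
  interpret block_space: fun_normed_space block_space sup_norm
    by (rule fun_normed_space_sup_norm[OF complex_subspace_block_space block_space_subset_l_inf])
  let ?p = "\<lambda>x. \<Sum>\<^sub>\<infinity>k. x k * limit_coef k"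
  have nonneg: "0 \<le> l_one_norm limit_coef"
    by (simp add: l_one_norm_def infsum_nonneg)
  have "norm (\<phi> x - ?p x) \<le> \<epsilon>" if "\<epsilon> > 0" for \<epsilon>
  proof -
    define \<delta> where "\<delta> = \<epsilon> / (C + l_one_norm limit_coef + 1)"
    have pos: "C + l_one_norm limit_coef + 1 > 0" using C_nonneg nonneg by linarith
    then have \<delta>: "\<delta> > 0" using that by (simp add: \<delta>_def)
    then obtain n v where v: "v \<in> lvl n" "\<And>k. norm (x k - v k) \<le> \<delta>" using block_spaceE[OF x] by blast
    have vp: "v \<in> block_space" using v lvl_subset_block_space by blast
    let ?d = "\<lambda>k. x k - v k"
    have d: "?d \<in> block_space" using x vp by (rule block_space.diff_mem)
    have "\<phi> x = \<phi> ?d + \<phi> v" using phi_add[OF d vp] by simp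
    moreover have "?p x = ?p ?d + ?p v"
    proof -
      have "?p (\<lambda>k. ?d k + v k) = ?p ?d + ?p v"
        unfolding distrib_right
        by (intro infsum_add pairing_abs_summable(1)[OF limit_coef_l_one, of _ "sup_norm ?d"]
            pairing_abs_summable(1)[OF limit_coef_l_one, of _ "sup_norm v"] block_space_norm_le d vp)
      then show ?thesis by simp
    qed
    ultimately have "\<phi> x - ?p x = \<phi> ?d - ?p ?d" using phi_lvl_limit[OF v(1)] by simp
    also have "norm \<dots> \<le> norm (\<phi> ?d) + norm (?p ?d)" by (rule norm_triangle_ineq4)
    also have "\<dots> \<le> C * \<delta> + \<delta> * l_one_norm limit_coef"
      using bound[OF d] mult_left_mono[OF sup_norm_le[of ?d \<delta>, OF v(2)] C_nonneg]
        pairing_abs_summable(2)[OF limit_coef_l_one, of ?d \<delta>, OF v(2)] by linarith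
    also have "\<dots> \<le> (C + l_one_norm limit_coef + 1) * \<delta>" using \<delta> by (simp add: algebra_simps)
    also have "\<dots> = \<epsilon>" using pos by (simp add: \<delta>_def)
    finally show ?thesis .
  qed
  then have "norm (\<phi> x - ?p x) \<le> 0" by (rule field_le_epsilon[where y = 0, simplified])
  then show ?thesis by simp
qed

end

lemma pairing_map_mem_dual:
  assumes a: "a \<in> l_one"
  shows "pairing_map block_space a \<in> dual_space block_space" "dual_norm block_space (pairing_map block_space a) \<le> l_one_norm a"
proof -
  have nonneg: "0 \<le> l_one_norm a"
    by (simp add: l_one_norm_def infsum_nonneg)
  have bound: "norm (pairing_map block_space a x) \<le> l_one_norm a * sup_norm x" if "x \<in> block_space" for x
    using pairing_abs_summable(2)[OF a block_space_norm_le[OF that]] that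
    by (simp add: pairing_map_def mult.commute)
  have summ: "(\<lambda>k. x k * a k) summable_on UNIV" if "x \<in> block_space" for x
    using pairing_abs_summable(1)[OF a block_space_norm_le[OF that]] .
  have mem: "(\<lambda>i. x i + y i) \<in> block_space" "(\<lambda>i. c * x i) \<in> block_space" if "x \<in> block_space" "y \<in> block_space" for x y c
    using complex_subspace_block_space that unfolding complex_subspace_def by blast+
  show "pairing_map block_space a \<in> dual_space block_space"
    unfolding dual_space_def mem_Collect_eq
  proof (intro conjI allI ballI impI)
    show "\<exists>C. \<forall>x\<in>block_space. norm (pairing_map block_space a x) \<le> C * sup_norm x" using bound by blast
    fix x y assume x: "x \<in> block_space" and y: "y \<in> block_space"
    show "pairing_map block_space a (\<lambda>i. x i + y i) = pairing_map block_space a x + pairing_map block_space a y"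
      using mem(1)[OF x y] x y summ by (simp add: pairing_map_def distrib_right infsum_add)
  next
    fix c x assume x: "x \<in> block_space"
    show "pairing_map block_space a (\<lambda>i. c * x i) = c * pairing_map block_space a x"
      using mem(2)[OF x x] x by (simp add: pairing_map_def mult.assoc infsum_cmult_right')
  qed (simp add: pairing_map_def)
  show "dual_norm block_space (pairing_map block_space a) \<le> l_one_norm a"
    using bound mult_left_mono[OF _ nonneg, of _ 1]
    by (intro dual_norm_le[OF complex_subspace_block_space]) (fastforce intro: order_trans)
qed

text \<open>A function norming \<open>a\<close> on a large window loses at most the tail of
  \<open>a\<close> outside it. The tail counts twice, as missing mass and as possible cancellation,
  so it is kept below \<open>\<epsilon> / 2\<close>.\<close>

lemma pairing_map_bounded_below:
  assumes a: "a \<in> l_one"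
  shows "l_one_norm a \<le> dual_norm block_space (pairing_map block_space a)"
proof (rule field_le_epsilon)
  fix \<epsilon> :: real assume \<epsilon>: "\<epsilon> > 0"
  have summ: "(\<lambda>k. norm (a k)) summable_on UNIV" using a by (simp add: l_one_def)
  have "(\<lambda>r. \<Sum>k\<in>win r. norm (a k)) \<longlonglongrightarrow> l_one_norm a"
    using filterlim_compose[OF has_sum_infsum[OF summ, unfolded has_sum_def] filterlim_win]
    unfolding l_one_norm_def .
  then have "eventually (\<lambda>r. (\<Sum>k\<in>win r. norm (a k)) > l_one_norm a - \<epsilon> / 2) sequentially"
    using \<epsilon> by (intro order_tendstoD(1)) auto
  then obtain n where n: "(\<Sum>k\<in>win n. norm (a k)) > l_one_norm a - \<epsilon> / 2"
    unfolding eventually_sequentially by blast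
  obtain x where x: "x \<in> lvl n" "\<And>k. norm (x k) \<le> 1" "\<And>k. k \<in> win n \<Longrightarrow> x k * a k = norm (a k)"
    by (rule lvl_norming[of n a]) blast
  have xp: "x \<in> block_space" using x lvl_subset_block_space by blast
  have s: "(\<lambda>k. x k * a k) summable_on A" "(\<lambda>k. norm (a k)) summable_on A" for A
    using summable_on_subset_banach[OF pairing_abs_summable(1)[OF a x(2)], of A]
      summable_on_subset_banach[OF summ, of A] by auto
  have abs: "(\<lambda>k. norm (x k * a k)) summable_on A" for A
    using s(2)[of A] x(2)
    by (rule_tac summable_on_comparison_test) (auto simp: norm_mult mult_left_le_one_le)
  have split: "infsum f UNIV = sum f (win n) + infsum f (- win n)"
    if "\<And>A. f summable_on A" for f :: "int \<Rightarrow> 'b::banach"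
    using infsum_Un_disjoint[OF that[of "win n"] that[of "- win n"]] by (simp add: Compl_partition)
  let ?t = "\<Sum>\<^sub>\<infinity>k\<in>- win n. norm (a k)"
  have t: "?t < \<epsilon> / 2" "l_one_norm a = (\<Sum>k\<in>win n. norm (a k)) + ?t"
    using n split[of "\<lambda>k. norm (a k)"] s(2) by (auto simp: l_one_norm_def)
  have "norm (\<Sum>\<^sub>\<infinity>k\<in>- win n. x k * a k) \<le> (\<Sum>\<^sub>\<infinity>k\<in>- win n. norm (x k * a k))"
    by (rule norm_infsum_bound[OF abs])
  also have "\<dots> \<le> ?t"
    using abs s(2) x(2) by (intro infsum_mono) (auto simp: norm_mult mult_left_le_one_le)
  finally have tail: "norm (\<Sum>\<^sub>\<infinity>k\<in>- win n. x k * a k) \<le> ?t" .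
  have "pairing_map block_space a x = complex_of_real (\<Sum>k\<in>win n. norm (a k)) + (\<Sum>\<^sub>\<infinity>k\<in>- win n. x k * a k)"
    using split[of "\<lambda>k. x k * a k"] s(1) xp x(3) by (simp add: pairing_map_def)
  then have "(\<Sum>k\<in>win n. norm (a k)) - ?t \<le> norm (pairing_map block_space a x)"
    using tail norm_triangle_ineq2[of "complex_of_real (\<Sum>k\<in>win n. norm (a k))" "- (\<Sum>\<^sub>\<infinity>k\<in>- win n. x k * a k)"]
    by (simp add: sum_nonneg del: of_real_sum)
  moreover have "norm (pairing_map block_space a x) \<le> dual_norm block_space (pairing_map block_space a)"
    using x sup_norm_le by (intro dual_norm_upper[OF block_space_subset_l_inf pairing_map_mem_dual(1)[OF a] xp]) blast
  ultimately show "l_one_norm a \<le> dual_norm block_space (pairing_map block_space a) + \<epsilon>"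
    using t by linarith
qed

lemma shift_invariant_predual_block_space: "shift_invariant_predual block_space"
proof -
  have "banach_isomorphism l_one l_one_norm (dual_space block_space) (dual_norm block_space) (pairing_map block_space)"
  proof (rule banach_isomorphismI[where C = 1 and K = 1])
    interpret l1: fun_normed_space "l_one :: (int \<Rightarrow> complex) set" l_one_norm
      by (rule fun_normed_space_l_one)
    show "fun_normed_space (l_one :: (int \<Rightarrow> complex) set) l_one_norm" ..
    show "fun_normed_space (dual_space block_space) (dual_norm block_space)"
      by (rule fun_normed_space_dual[OF complex_subspace_block_space block_space_subset_l_inf])
    show "complex_linear_on l_one (pairing_map block_space)"
      unfolding complex_linear_on_def
    proof (intro conjI ballI allI ext)
      fix a b :: "int \<Rightarrow> complex" and x assume ab: "a \<in> l_one" "b \<in> l_one"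
      show "pairing_map block_space (\<lambda>i. a i + b i) x = pairing_map block_space a x + pairing_map block_space b x"
        using infsum_add[OF pairing_abs_summable(1)[OF ab(1) block_space_norm_le]
            pairing_abs_summable(1)[OF ab(2) block_space_norm_le], of x x]
        by (simp add: pairing_map_def distrib_left)
    next
      fix c and a :: "int \<Rightarrow> complex" and x assume "a \<in> l_one"
      show "pairing_map block_space (\<lambda>i. c * a i) x = c * pairing_map block_space a x"
        by (simp add: pairing_map_def mult.left_commute infsum_cmult_right')
    qed
    show "pairing_map block_space ` l_one = dual_space block_space"
    proof
      show "pairing_map block_space ` l_one \<subseteq> dual_space block_space" using pairing_map_mem_dual(1) by blast
      show "dual_space block_space \<subseteq> pairing_map block_space ` l_one"
      proof
        fix \<phi> assume \<phi>: "\<phi> \<in> dual_space block_space"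
        obtain C where C: "C \<ge> 0" "\<And>x. x \<in> block_space \<Longrightarrow> norm (\<phi> x) \<le> C * sup_norm x"
          using dual_space_bound[OF block_space_subset_l_inf \<phi>] by blast
        interpret block_functional \<phi> C using \<phi> C by unfold_locales
        \<comment> \<open>Equality holds off \<open>block_space\<close> as well, since functionals
          and \<open>pairing_map\<close> are both extended by zero.\<close>
        have "\<phi> x = pairing_map block_space limit_coef x" for x
          using phi_block_space_limit[of x] \<phi> by (simp add: pairing_map_def dual_space_def)
        then show "\<phi> \<in> pairing_map block_space ` l_one" using limit_coef_l_one by blast
      qed
    qed
  qed (use pairing_map_mem_dual(2) pairing_map_bounded_below in simp_all)
  then show ?thesis
    unfolding shift_invariant_predual_def concrete_predual_def
    using block_space_subset_l_inf complex_subspace_block_space closedin_block_space bilateral_shift_block_space by blast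
qed

section \<open>Non-isomorphism with \<open>c\<^sub>0\<close>\<close>

text \<open>In contrast to \<open>dual_space\<close>, values off \<open>V\<close> are unrestricted
  and the constant is explicit, so point evaluations and compositions with linear maps qualify as
  they stand.\<close>

definition bounded_functional ::
  "('i \<Rightarrow> complex) set \<Rightarrow> real \<Rightarrow> (('i \<Rightarrow> complex) \<Rightarrow> complex) \<Rightarrow> bool" where
  "bounded_functional V c \<alpha> \<longleftrightarrow>
     (\<forall>x\<in>V. \<forall>y\<in>V. \<alpha> (\<lambda>i. x i + y i) = \<alpha> x + \<alpha> y) \<and>
     (\<forall>a. \<forall>x\<in>V. \<alpha> (\<lambda>i. a * x i) = a * \<alpha> x) \<and>
     (\<forall>x\<in>V. norm (\<alpha> x) \<le> c * sup_norm x)"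

lemma bounded_functionalD:
  assumes "bounded_functional V c \<alpha>" "x \<in> V"
  shows "y \<in> V \<Longrightarrow> \<alpha> (\<lambda>i. x i + y i) = \<alpha> x + \<alpha> y"
    and "\<alpha> (\<lambda>i. a * x i) = a * \<alpha> x"
    and "norm (\<alpha> x) \<le> c * sup_norm x"
  using assms by (auto simp: bounded_functional_def)

lemma bounded_functional_diff:
  assumes "bounded_functional V c \<alpha>" "bounded_functional V d \<beta>"
  shows "bounded_functional V (c + d) (\<lambda>x. \<alpha> x - \<beta> x)"
proof -
  have "norm (\<alpha> x - \<beta> x) \<le> (c + d) * sup_norm x" if "x \<in> V" for x
    using assms that norm_triangle_ineq4[of "\<alpha> x" "\<beta> x"]
    by (fastforce simp: bounded_functional_def distrib_right)
  then show ?thesis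
    using assms by (simp add: bounded_functional_def algebra_simps)
qed

section \<open>Functionals on \<open>c_zero\<close> and their coefficients\<close>

definition c_unit :: "nat \<Rightarrow> nat \<Rightarrow> complex" where "c_unit n m = of_bool (m = n)"

lemma finite_support_c_zero:
  assumes "\<And>m. m \<ge> N \<Longrightarrow> u m = 0"
  shows "u \<in> c_zero"
  unfolding c_zero_def mem_Collect_eq
  by (rule tendsto_eventually) (use assms eventually_sequentially in auto)

lemma c_unit_c_zero: "c_unit n \<in> c_zero"
  by (rule finite_support_c_zero[of "Suc n"]) (simp add: c_unit_def)

lemma c_zero_functional_expansion:
  assumes \<beta>: "bounded_functional c_zero c \<beta>"
  shows "\<beta> (\<lambda>m. if m < N then u m else 0) = (\<Sum>n<N. u n * \<beta> (c_unit n))"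
proof (induction N)
  case 0
  have "(\<lambda>m. 0) \<in> c_zero" by (rule finite_support_c_zero) simp
  then show ?case using bounded_functionalD(2)[OF \<beta>, of "\<lambda>m. 0" 0] by simp
next
  case (Suc N)
  let ?u = "\<lambda>m. if m < N then u m else 0"
  have u: "?u \<in> c_zero" and v: "(\<lambda>m. u N * c_unit N m) \<in> c_zero"
    by (rule finite_support_c_zero[of "Suc N"], simp add: c_unit_def)+
  have eq: "(\<lambda>m. if m < Suc N then u m else 0) = (\<lambda>m. ?u m + u N * c_unit N m)"
    by (auto simp: c_unit_def fun_eq_iff less_Suc_eq)
  have "\<beta> (\<lambda>m. ?u m + u N * c_unit N m) = \<beta> ?u + \<beta> (\<lambda>m. u N * c_unit N m)"
    by (rule bounded_functionalD(1)[OF \<beta> u v])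
  also have "\<beta> (\<lambda>m. u N * c_unit N m) = u N * \<beta> (c_unit N)"
    by (rule bounded_functionalD(2)[OF \<beta> c_unit_c_zero])
  finally show ?case using Suc unfolding eq by simp
qed

text \<open>Tests the functional against the conjugate signs of its first \<open>N\<close>
  coefficients, a finitely supported vector of norm at most 1.\<close>

lemma c_zero_functional_sum_le:
  assumes \<beta>: "bounded_functional c_zero c \<beta>" and "c \<ge> 0"
  shows "(\<Sum>n<N. norm (\<beta> (c_unit n))) \<le> c"
proof -
  define u where "u m = (if m < N then cnj (sgn (\<beta> (c_unit m))) else 0)" for m
  have "complex_of_real (\<Sum>n<N. norm (\<beta> (c_unit n))) = (\<Sum>n<N. u n * \<beta> (c_unit n))"
    unfolding of_real_sum
  proof (rule sum.cong)
    fix n assume "n \<in> {..<N}"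
    then have "u n * \<beta> (c_unit n) = (\<beta> (c_unit n) * cnj (\<beta> (c_unit n))) / norm (\<beta> (c_unit n))"
      by (simp add: u_def sgn_div_norm scaleR_conv_of_real divide_inverse)
    also have "\<dots> = norm (\<beta> (c_unit n))"
      by (simp add: complex_norm_square[symmetric] power2_eq_square)
    finally show "complex_of_real (norm (\<beta> (c_unit n))) = u n * \<beta> (c_unit n)" by simp
  qed simp
  also have "\<dots> = \<beta> (\<lambda>m. if m < N then u m else 0)"
    by (rule c_zero_functional_expansion[OF \<beta>, symmetric])
  also have "(\<lambda>m. if m < N then u m else 0) = u" by (auto simp: u_def)
  finally have eq: "complex_of_real (\<Sum>n<N. norm (\<beta> (c_unit n))) = \<beta> u" .
  have "(\<Sum>n<N. norm (\<beta> (c_unit n))) = norm (\<beta> u)"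
    unfolding eq[symmetric] norm_of_real by (simp add: sum_nonneg)
  also have "\<dots> \<le> c * sup_norm u"
    by (rule bounded_functionalD(3)[OF \<beta> finite_support_c_zero[of N]]) (simp add: u_def)
  also have "\<dots> \<le> c * 1"
    using \<open>c \<ge> 0\<close> by (intro mult_left_mono sup_norm_le) (auto simp: u_def norm_sgn)
  finally show ?thesis by simp
qed

lemma c_zero_functional_summable:
  assumes "bounded_functional c_zero c \<beta>" "c \<ge> 0"
  shows "summable (\<lambda>n. norm (\<beta> (c_unit n)))" "(\<Sum>n. norm (\<beta> (c_unit n))) \<le> c"
proof -
  show *: "summable (\<lambda>n. norm (\<beta> (c_unit n)))"
    using c_zero_functional_sum_le[OF assms] by (intro bounded_imp_summable[of _ c]) (auto simp: lessThan_Suc_atMost[symmetric] simp del: sum.lessThan_Suc)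
  show "(\<Sum>n. norm (\<beta> (c_unit n))) \<le> c"
    using suminf_le_const[OF *] c_zero_functional_sum_le[OF assms] by blast
qed

text \<open>Finitely supported vectors are dense in \<open>c_zero\<close>, so the coefficients
  control the functional. With the preceding bound this is the isometric duality of
  \<open>c_zero\<close> and \<open>l_one\<close>.\<close>

lemma c_zero_functional_bound:
  assumes \<beta>: "bounded_functional c_zero c \<beta>" and c: "c \<ge> 0" and u: "u \<in> c_zero"
  shows "norm (\<beta> u) \<le> sup_norm u * (\<Sum>n. norm (\<beta> (c_unit n)))"
proof (rule field_le_epsilon)
  fix \<epsilon> :: real assume \<epsilon>: "\<epsilon> > 0"
  have u_inf: "u \<in> l_inf" using u c_zero_subset_l_inf by blast
  have "\<epsilon> / (c + 1) > 0" using \<epsilon> c by simp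
  then obtain N where N: "\<And>m. m \<ge> N \<Longrightarrow> norm (u m) < \<epsilon> / (c + 1)"
    using LIMSEQ_D[of u 0] u unfolding c_zero_def by auto
  let ?v = "\<lambda>m. if m < N then u m else 0" and ?w = "\<lambda>m. if m < N then 0 else u m"
  have v: "?v \<in> c_zero" by (rule finite_support_c_zero[of N]) simp
  have "eventually (\<lambda>m. u m = ?w m) sequentially"
    unfolding eventually_sequentially by (intro exI[of _ N]) simp
  then have w: "?w \<in> c_zero"
    using u unfolding c_zero_def by (auto intro: Lim_transform_eventually)
  have "u = (\<lambda>m. ?v m + ?w m)" by auto
  then have "\<beta> u = \<beta> ?v + \<beta> ?w"
    using bounded_functionalD(1)[OF \<beta> v w] by simp
  then have "norm (\<beta> u) \<le> norm (\<beta> ?v) + norm (\<beta> ?w)" by (simp add: norm_triangle_ineq)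
  moreover have "norm (\<beta> ?w) \<le> \<epsilon>"
  proof -
    have "norm (\<beta> ?w) \<le> c * sup_norm ?w" by (rule bounded_functionalD(3)[OF \<beta> w])
    also have "\<dots> \<le> c * (\<epsilon> / (c + 1))"
      using c \<epsilon> N by (intro mult_left_mono sup_norm_le) (auto simp: less_imp_le)
    also have "\<dots> \<le> \<epsilon>" using c \<epsilon> by (simp add: field_simps)
    finally show ?thesis .
  qed
  moreover have "norm (\<beta> ?v) \<le> sup_norm u * (\<Sum>n. norm (\<beta> (c_unit n)))"
  proof -
    have "norm (\<beta> ?v) \<le> (\<Sum>n<N. norm (u n * \<beta> (c_unit n)))"
      unfolding c_zero_functional_expansion[OF \<beta>] by (rule norm_sum)
    also have "\<dots> \<le> (\<Sum>n<N. sup_norm u * norm (\<beta> (c_unit n)))"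
      by (intro sum_mono) (simp add: norm_mult mult_right_mono norm_le_sup_norm[OF u_inf])
    also have "\<dots> \<le> sup_norm u * (\<Sum>n. norm (\<beta> (c_unit n)))"
      unfolding sum_distrib_left[symmetric]
      using c_zero_functional_summable(1)[OF \<beta> c] sup_norm_nonneg[OF u_inf]
      by (intro mult_left_mono sum_le_suminf) auto
    finally show ?thesis .
  qed
  ultimately show "norm (\<beta> u) \<le> sup_norm u * (\<Sum>n. norm (\<beta> (c_unit n))) + \<epsilon>" by linarith
qed

text \<open>
  Applied to the values of functionals at the unit vectors of \<open>c\<^sub>0\<close>, so that \<open>lim\<close> is weak*
  convergence.
\<close>

lemma summable_norm_split:
  fixes u :: "nat \<Rightarrow> complex"
  assumes u: "summable (\<lambda>n. norm (u n))" and v: "\<And>m. summable (\<lambda>n. norm (v m n))"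
    and lim: "\<And>n. (\<lambda>m. v m n) \<longlonglongrightarrow> u n" and \<eta>: "\<eta> > 0"
  shows "eventually (\<lambda>m. (\<Sum>n. norm (v m n)) \<ge> (\<Sum>n. norm (u n)) + (\<Sum>n. norm (v m n - u n)) - \<eta>) sequentially"
proof -
  have d: "summable (\<lambda>n. norm (v m n - u n))" for m
    by (rule summable_comparison_test'[OF summable_add[OF v[of m] u], of 0]) (simp add: norm_triangle_ineq4)
  have tail: "(\<Sum>n. f n) = (\<Sum>n. f (n + M)) + (\<Sum>n<M. f n)" if "summable f" for f :: "nat \<Rightarrow> real" and M
    using suminf_split_initial_segment[OF that] .
  have "(\<lambda>M. \<Sum>n. norm (u (n + M))) \<longlonglongrightarrow> 0"
    by (rule suminf_exist_split2[OF u])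
  \<comment> \<open>Before \<open>M\<close> the sequence \<open>v m\<close> is eventually close to
    \<open>u\<close>; beyond \<open>M\<close>, \<open>v m\<close> and \<open>v m - u\<close> differ
    by at most the tail of \<open>u\<close>. Both errors enter twice, hence
    \<open>\<eta> / 4\<close>.\<close>
  then obtain M where M: "(\<Sum>n. norm (u (n + M))) < \<eta> / 4"
    using order_tendstoD(2)[of _ 0 sequentially "\<eta> / 4"] \<eta> unfolding eventually_sequentially by fastforce
  have "(\<lambda>m. \<Sum>n<M. norm (v m n - u n)) \<longlonglongrightarrow> (\<Sum>n<M. norm (u n - u n))"
    by (intro tendsto_intros lim)
  then have "eventually (\<lambda>m. (\<Sum>n<M. norm (v m n - u n)) < \<eta> / 4) sequentially"
    using \<eta> by (intro order_tendstoD(2)) auto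
  then show ?thesis
  proof (eventually_elim)
    fix m assume m: "(\<Sum>n<M. norm (v m n - u n)) < \<eta> / 4"
    have "(\<Sum>n<M. norm (u n)) \<le> (\<Sum>n<M. norm (v m n) + norm (v m n - u n))"
      by (intro sum_mono) (metis norm_minus_commute norm_triangle_sub add.commute)
    then have 1: "(\<Sum>n<M. norm (u n)) \<le> (\<Sum>n<M. norm (v m n)) + (\<Sum>n<M. norm (v m n - u n))"
      by (simp add: sum.distrib)
    have s: "summable (\<lambda>n. norm (v m (n + M)))" "summable (\<lambda>n. norm (u (n + M)))"
      "summable (\<lambda>n. norm (v m (n + M) - u (n + M)))"
      using v u d summable_iff_shift[of "\<lambda>n. norm (v m n)" M] summable_iff_shift[of "\<lambda>n. norm (u n)" M]
        summable_iff_shift[of "\<lambda>n. norm (v m n - u n)" M] by auto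
    have "(\<Sum>n. norm (v m (n + M) - u (n + M))) \<le> (\<Sum>n. norm (v m (n + M)) + norm (u (n + M)))"
      using s by (intro suminf_le summable_add) (auto simp: norm_triangle_ineq4)
    also have "\<dots> = (\<Sum>n. norm (v m (n + M))) + (\<Sum>n. norm (u (n + M)))"
      using s by (intro suminf_add[symmetric])
    finally show "(\<Sum>n. norm (v m n)) \<ge> (\<Sum>n. norm (u n)) + (\<Sum>n. norm (v m n - u n)) - \<eta>"
      using 1 m M tail[OF u, of M] tail[OF v[of m], of M] tail[OF d[of m], of M] by linarith
  qed
qed

section \<open>Chains of iterated weak* limits\<close>

definition orbit :: "nat \<Rightarrow> int \<Rightarrow> nat \<Rightarrow> (int \<Rightarrow> complex) \<Rightarrow> complex" where
  "orbit i k r x = (avg i ^^ r) x k"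

text \<open>\<open>orbit i k r\<close> pairs \<open>x\<close> with the translate to \<open>k\<close>
  of the \<open>r\<close>-th convolution power of \<open>\<nu>\<^sub>i\<close>, whose
  \<open>l_one\<close> norm is \<open>lam i ^ r\<close>; each averaging is a contraction.\<close>

lemma orbit_bounded_functional: "bounded_functional block_space 1 (orbit i k r)"
proof -
  have add: "(avg i ^^ r) (\<lambda>k. x k + y k) = (\<lambda>k. (avg i ^^ r) x k + (avg i ^^ r) y k)" for x y
    by (induction r) (auto simp: avg_add)
  have scale: "(avg i ^^ r) (\<lambda>k. a * x k) = (\<lambda>k. a * (avg i ^^ r) x k)" for a x
    by (induction r) (auto simp: avg_scale)
  have "norm ((avg i ^^ r) x k) \<le> sup_norm x" if "x \<in> block_space" for x
  proof (induction r arbitrary: k)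
    case 0
    then show ?case using block_space_norm_le[OF that] by simp
  next
    case (Suc r)
    have "0 \<le> sup_norm x" using that block_space_subset_l_inf sup_norm_nonneg by blast
    have "norm ((avg i ^^ Suc r) x k) \<le> lam i * sup_norm x"
      using avg_bound[OF Suc Suc] by simp
    also have "\<dots> \<le> 1 * sup_norm x"
      using lam_bounds(2) \<open>0 \<le> sup_norm x\<close> by (intro mult_right_mono) (auto simp: less_imp_le)
    finally show ?case by simp
  qed
  then show ?thesis
    by (simp add: bounded_functional_def orbit_def add scale)
qed

text \<open>Functions of a fixed level satisfy the block equation exactly at late indices of colour
  \<open>i\<close>; uniform approximation gives the limit in general.\<close>

lemma block_space_block_limit:
  assumes x: "x \<in> block_space"
  shows "(\<lambda>m. x (k + tau (prod_encode (i, m)))) \<longlonglongrightarrow> avg i x k"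
proof (rule LIMSEQ_I)
  fix \<epsilon> :: real assume "\<epsilon> > 0"
  then have "\<epsilon> / 3 > 0" by simp
  then obtain n v where v: "v \<in> lvl n" "\<And>k. norm (x k - v k) \<le> \<epsilon> / 3" using block_spaceE[OF x] by blast
  have "norm (x (k + tau (prod_encode (i, m))) - avg i x k) < \<epsilon>"
    if m: "m \<ge> n + nat \<bar>k\<bar> + nat \<bar>k - gap i\<bar>" for m
  proof -
    define j where "j = prod_encode (i, m)"
    have "m \<le> j" using le_prod_encode_2 by (simp add: j_def)
    then have j: "n \<le> j" "k \<in> win j" "k - gap i \<in> win j" "col j = i"
      using m by (auto intro!: eventually_in_win simp: col_def j_def)
    have pos: "(16::int) ^ j > 0" by simp
    have "k + tau j \<in> win (Suc j)" and high: "k + tau j > 4 * 16 ^ j"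
      using j(2) pos unfolding in_win_iff tau_def power_Suc by linarith+
    then have "v (k + tau j) = grow j (trunc j v) (k + tau j)"
      using lvl_apply[OF v(1) j(1)] by blast
    also have "\<dots> = avg i v k"
      unfolding grow_high[OF trunc_idem high] using j by (simp add: avg_def trunc_def)
    finally have "x (k + tau j) - avg i x k = (x (k + tau j) - v (k + tau j)) - avg i (\<lambda>l. x l - v l) k"
      by (simp add: avg_def algebra_simps)
    then have "norm (x (k + tau j) - avg i x k) \<le> norm (x (k + tau j) - v (k + tau j)) + norm (avg i (\<lambda>l. x l - v l) k)"
      by (metis norm_triangle_ineq4)
    moreover have "norm (avg i (\<lambda>l. x l - v l) k) \<le> lam i * (\<epsilon> / 3)"
      by (rule avg_bound) (rule v(2))+
    moreover have "lam i * (\<epsilon> / 3) \<le> 1 * (\<epsilon> / 3)"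
      using lam_bounds(2)[of i] \<open>\<epsilon> > 0\<close> by (intro mult_right_mono) auto
    ultimately show ?thesis using v(2)[of "k + tau j"] \<open>\<epsilon> > 0\<close> unfolding j_def by linarith
  qed
  then show "\<exists>M. \<forall>m\<ge>M. norm (x (k + tau (prod_encode (i, m))) - avg i x k) < \<epsilon>" by blast
qed

text \<open>An iterated average is a finite combination of point values, so the limit passes through
  it. The limit has one more averaging than the approximating functionals.\<close>

lemma orbit_limit:
  assumes x: "x \<in> block_space"
  shows "(\<lambda>m. orbit i (k + tau (prod_encode (i, m))) r x) \<longlonglongrightarrow> orbit i k (Suc r) x"
proof -
  have "(\<lambda>m. (avg i ^^ r) x (k + tau (prod_encode (i, m)))) \<longlonglongrightarrow> avg i ((avg i ^^ r) x) k"
  proof (induction r arbitrary: k)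
    case 0
    then show ?case using block_space_block_limit[OF x] by simp
  next
    case (Suc r)
    have "(\<lambda>m. (avg i ^^ r) x (k + tau (prod_encode (i, m)) - gap i)) \<longlonglongrightarrow> avg i ((avg i ^^ r) x) (k - gap i)"
      using Suc[of "k - gap i"] by (simp add: algebra_simps)
    from tendsto_mult_left[OF tendsto_add[OF Suc[of k] this], of "complex_of_real (lam i / 2)"]
    show ?case by (simp add: avg_def[of i "avg i ((avg i ^^ r) x)"] avg_def[of i "(avg i ^^ r) x" "_ + _"])
  qed
  then show ?thesis by (simp add: orbit_def)
qed

text \<open>The \<open>r\<close>-fold average sees only points between \<open>k - r * gap i\<close>
  and \<open>k\<close>, with total weight \<open>lam i ^ r\<close>.\<close>

lemma orbit_const:
  assumes "\<And>l. k - int r * gap i \<le> l \<Longrightarrow> l \<le> k \<Longrightarrow> x l = c"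
  shows "orbit i k r x = complex_of_real (lam i) ^ r * c"
  using assms
proof (induction r arbitrary: k)
  case (Suc r)
  have "orbit i k r x = complex_of_real (lam i) ^ r * c"
    by (rule Suc.IH, rule Suc.prems) (use gap_col_le(2)[of i] in \<open>simp_all add: algebra_simps\<close>)
  moreover have "orbit i (k - gap i) r x = complex_of_real (lam i) ^ r * c"
    by (rule Suc.IH, rule Suc.prems) (use gap_col_le(2)[of i] in \<open>simp_all add: algebra_simps\<close>)
  ultimately
  show ?case by (simp add: orbit_def avg_def)
qed (simp add: orbit_def)

text \<open>For large \<open>t\<close> the first functional lives strictly to the right of
  \<open>k\<close> and the second at or to the left of \<open>k\<close>, so a step function at
  \<open>k\<close> sees all of the first and none of the second.\<close>

lemma orbit_separation:
  assumes t: "t > int r * gap i"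
  obtains x where "x \<in> block_space" "sup_norm x \<le> 1" "orbit i (k + t) r x - orbit i k (Suc r) x = complex_of_real (lam i ^ r)"
proof -
  define n where "n = nat \<bar>k + t\<bar> + nat \<bar>k - int (Suc r) * gap i\<bar>"
  have g: "int (Suc r) * gap i \<ge> 0" "int r * gap i \<ge> 0" using gap_col_le(2)[of i] by auto
  have "k + t \<in> win n" "k - int (Suc r) * gap i \<in> win n"
    by (auto intro!: eventually_in_win simp: n_def)
  then have win: "l \<in> win n" if "k - int (Suc r) * gap i \<le> l" "l \<le> k + t" for l
    using that by (auto simp: win_def)
  obtain x where x: "x \<in> lvl n" "\<And>l. l \<in> win n \<Longrightarrow> x l = trunc n (\<lambda>l. of_bool (l > k)) l"
    using lvl_extension[of n "trunc n (\<lambda>l. of_bool (l > k))"] by auto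
  have xl: "x l = of_bool (l > k)" if "l \<in> win n" for l using x(2)[OF that] that by (simp add: trunc_def)
  have "norm (x l) \<le> 1" for l
    by (rule lvl_bound[OF x(1)]) (simp add: xl)
  then have "sup_norm x \<le> 1" by (rule sup_norm_le)
  moreover have "orbit i (k + t) r x = complex_of_real (lam i) ^ r * 1"
    by (rule orbit_const) (use t g xl win in auto)
  moreover have "orbit i k (Suc r) x = complex_of_real (lam i) ^ Suc r * 0"
    by (rule orbit_const) (use t g xl win in auto)
  ultimately show ?thesis using x(1) lvl_subset_block_space by (intro that[of x]) auto
qed

text \<open>An isomorphism would transport the \<open>l_one\<close> norm of the dual of
  \<open>c_zero\<close> to an equivalent norm \<open>N\<close> on functionals. There each weak*
  limit loses the norm of the difference, and a long enough chain exceeds the bound on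
  \<open>N\<close>.\<close>

lemma block_space_not_isomorphic_c_zero: "\<not> banach_isomorphic block_space sup_norm c_zero sup_norm"
proof
  assume "banach_isomorphic block_space sup_norm c_zero sup_norm"
  then obtain T where T: "banach_isomorphism block_space sup_norm c_zero sup_norm T"
    by (auto simp: banach_isomorphic_def)
  have block_space: "fun_normed_space block_space sup_norm"
    by (rule fun_normed_space_sup_norm[OF complex_subspace_block_space block_space_subset_l_inf])
  have c0: "fun_normed_space c_zero sup_norm"
    by (rule fun_normed_space_sup_norm[OF complex_subspace_c_zero c_zero_subset_l_inf])
  obtain G K where K: "K > 0" and G: "complex_linear_on c_zero G" "\<And>y. y \<in> c_zero \<Longrightarrow> G y \<in> block_space"
      "\<And>y. y \<in> c_zero \<Longrightarrow> sup_norm (G y) \<le> K * sup_norm y"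
    and T: "\<And>x. x \<in> block_space \<Longrightarrow> T x \<in> c_zero" "\<And>x. x \<in> block_space \<Longrightarrow> G (T x) = x"
      "\<And>x. x \<in> block_space \<Longrightarrow> sup_norm (T x) \<le> K * sup_norm x"
    using banach_isomorphismE[OF block_space c0 T] by metis
  define N where "N \<alpha> = (\<Sum>n. norm (\<alpha> (G (c_unit n))))" for \<alpha> :: "(int \<Rightarrow> complex) \<Rightarrow> complex"
  have pull: "bounded_functional c_zero (c * K) (\<lambda>y. \<alpha> (G y))"
    if \<alpha>: "bounded_functional block_space c \<alpha>" and "c \<ge> 0" for \<alpha> c
  proof -
    have "norm (\<alpha> (G y)) \<le> c * K * sup_norm y" if "y \<in> c_zero" for y
    proof -
      have "norm (\<alpha> (G y)) \<le> c * sup_norm (G y)"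
        using \<alpha> G(2)[OF that] unfolding bounded_functional_def by blast
      also have "\<dots> \<le> c * (K * sup_norm y)" using G(3)[OF that] \<open>c \<ge> 0\<close> by (rule mult_left_mono)
      finally show ?thesis by (simp add: mult.assoc)
    qed
    then show ?thesis
      using \<alpha> G(1,2) unfolding bounded_functional_def complex_linear_on_def by simp
  qed
  have summ: "summable (\<lambda>n. norm (\<alpha> (G (c_unit n))))" "N \<alpha> \<le> c * K"
    if "bounded_functional block_space c \<alpha>" "c \<ge> 0" for \<alpha> c
    using c_zero_functional_summable[OF pull[OF that]] that K by (auto simp: N_def)
  have lower: "norm (\<alpha> x) \<le> K * N \<alpha>"
    if \<alpha>: "bounded_functional block_space c \<alpha>" "c \<ge> 0" and x: "x \<in> block_space" "sup_norm x \<le> 1" for \<alpha> c x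
  proof -
    have "norm (\<alpha> (G (T x))) \<le> sup_norm (T x) * N \<alpha>"
      unfolding N_def using \<alpha> x K T(1) by (intro c_zero_functional_bound[OF pull]) auto
    also have "\<dots> \<le> K * N \<alpha>"
    proof (rule mult_right_mono)
      show "sup_norm (T x) \<le> K" using T(3)[OF x(1)] mult_left_mono[OF x(2), of K] K by linarith
      show "0 \<le> N \<alpha>" unfolding N_def by (rule suminf_nonneg[OF summ(1)[OF \<alpha>]]) simp
    qed
    finally show ?thesis using T(2)[OF x(1)] by simp
  qed
  \<comment> \<open>Each link of the chain gains \<open>1 / (4 * K)\<close>, while \<open>N\<close>
    is at most \<open>K\<close> on all orbits; more than \<open>4 * K * K\<close> links give a
    contradiction. With \<open>i = 2 * R\<close>, Bernoulli's inequality keeps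
    \<open>lam i ^ r\<close> at least 1/2 along the chain.\<close>
  define R where "R = nat \<lceil>4 * K * K\<rceil> + 1"
  have R: "real R > 4 * K * K" unfolding R_def by linarith
  define i where "i = 2 * R"
  have lam: "lam i ^ r \<ge> 1 / 2" if "r \<le> R" for r
  proof -
    have "1 / 2 \<le> 1 + real R * (- 1 / (real i + 2))" by (simp add: i_def field_simps)
    also have "\<dots> \<le> (1 + - 1 / (real i + 2)) ^ R"
      by (rule Bernoulli_inequality) (simp add: field_simps)
    also have "\<dots> = lam i ^ R" by (simp add: lam_def)
    also have "\<dots> \<le> lam i ^ r"
      using that lam_bounds[of i] by (intro power_decreasing) auto
    finally show ?thesis .
  qed
  \<comment> \<open>The induction runs from the last limit back to the point evaluation, passing
    from a limit to a late approximant with one averaging fewer.\<close>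
  have "\<exists>k. N (orbit i k (R - r)) \<ge> real r / (4 * K)" if "r \<le> R" for r
    using that
  proof (induction r)
    case 0
    have "0 \<le> N (orbit i 0 R)"
      unfolding N_def by (rule suminf_nonneg[OF summ(1)[OF orbit_bounded_functional]]) auto
    then show ?case by auto
  next
    case (Suc r)
    then obtain k where k: "N (orbit i k (R - r)) \<ge> real r / (4 * K)" by auto
    define s where "s = R - Suc r"
    have s: "R - r = Suc s" "s \<le> R" using Suc.prems by (auto simp: s_def)
    let ?t = "\<lambda>m. tau (prod_encode (i, m))"
    let ?d = "\<lambda>m x. orbit i (k + ?t m) s x - orbit i k (Suc s) x"
    \<comment> \<open>The difference has norm \<open>N\<close> at least \<open>1 / (2 * K)\<close>,
      so a defect of \<open>1 / (4 * K)\<close> gives away half of the gain.\<close>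
    have "eventually (\<lambda>m. N (orbit i (k + ?t m) s) \<ge> N (orbit i k (Suc s)) + N (?d m) - 1 / (4 * K)) sequentially"
      unfolding N_def
      using summ(1)[OF orbit_bounded_functional] K
      by (intro summable_norm_split orbit_limit G(2) c_unit_c_zero) auto
    then obtain M where M: "\<And>m. m \<ge> M \<Longrightarrow>
        N (orbit i (k + ?t m) s) \<ge> N (orbit i k (Suc s)) + N (?d m) - 1 / (4 * K)"
      unfolding eventually_sequentially by blast
    \<comment> \<open>One summand reaches the range of the eventual estimate, the other makes the
      translation exceed \<open>s * gap i\<close> as required by
      \<open>orbit_separation\<close>.\<close>
    define m where "m = M + nat (int s * gap i)"
    have "?t m > int s * gap i"
    proof -
      have "nat (int s * gap i) \<le> prod_encode (i, m)"
        using le_prod_encode_2[of m i] by (simp add: m_def)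
      then have "int s * gap i \<in> win (prod_encode (i, m))"
        using gap_col_le(2)[of i] by (intro eventually_in_win) auto
      moreover have "(16::int) ^ prod_encode (i, m) > 0" by simp
      ultimately show ?thesis unfolding tau_def in_win_iff by linarith
    qed
    then obtain x where x: "x \<in> block_space" "sup_norm x \<le> 1" "?d m x = complex_of_real (lam i ^ s)"
      using orbit_separation by blast
    have "1 / 2 \<le> norm (?d m x)"
      unfolding x(3) norm_of_real using lam[OF s(2)] by linarith
    also have "\<dots> \<le> K * N (?d m)"
      using lower[OF bounded_functional_diff[OF orbit_bounded_functional orbit_bounded_functional] _ x(1,2)] by simp
    finally have "N (?d m) \<ge> 1 / (2 * K)" using K by (simp add: field_simps)
    then have "N (orbit i (k + ?t m) s) \<ge> real r / (4 * K) + 1 / (2 * K) - 1 / (4 * K)"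
      using M[of m] k s(1) by (simp add: m_def)
    also have "real r / (4 * K) + 1 / (2 * K) - 1 / (4 * K) = real (Suc r) / (4 * K)"
      using K by (simp add: field_simps)
    finally show ?case unfolding s_def by blast
  qed
  from this[of R] obtain k where "N (orbit i k 0) \<ge> real R / (4 * K)" by auto
  moreover have "N (orbit i k 0) \<le> 1 * K"
    by (rule summ(2)[OF orbit_bounded_functional]) simp
  ultimately have "real R / (4 * K) \<le> K" by simp
  then show False using R K by (simp add: field_simps)
qed

theorem theorem5p8:
  "\<exists>E :: (int \<Rightarrow> complex) set.
     shift_invariant_predual E \<and> \<not> banach_isomorphic E sup_norm c_zero sup_norm"
  using shift_invariant_predual_block_space block_space_not_isomorphic_c_zero by blast

end
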